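(* Let $T$ be a polygonal transformation in $\mathbb{P}^1$ admitting a linear scaling symmetry. Let $P$ be a closed $n$-gon in $\mathbb{P}^1$. For $1\leq k\leq\lfloor n/2\rfloor$, define $$G_k=\sum_{1\leq i_1<\dots<i_k\leq n} \frac{c_{i_1}'(1)}{c_{i_1}(1)}\cdots\frac{c_{i_k}'(1)}{c_{i_k}(1)}\cdot\frac{(p_{i_1}-p_{i_k+1})(p_{i_2}-p_{i_1+1})\cdots(p_{i_k}-p_{i_{k-1}+1})}{(p_{i_1}-p_{i_1+1})(p_{i_2}-p_{i_2+1})\cdots(p_{i_k}-p_{i_k+1})}$$ and $G_0=2$. These quantities are preserved by the dynamic and are projective invariant. Moreover, for every $t\in\mathbb{G}_m$, $$\mathrm{Tr}(M(t))=\sum_{k=0}^{\lfloor n/2\rfloor}\frac{G_k}{k!}(t-1)^k.$$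
   Context: Let $F$ be a field, $\mathbb{P}^1=\mathbb{P}^1(F)$, $\mathrm{PGL}_2=\mathrm{GL}_2(F)/F^*$, $\mathbb{G}_m=F^*$ (as algebraic group). A (twisted) $n$-gon in $\mathbb{P}^1$ is $P=((p_i)_{i\in\mathbb{Z}},M)$ with $p_i\in\mathbb{P}^1$, monodromy $M\in\mathrm{PGL}_2$, $p_{i+n}=Mp_i$, such that $p_i,p_{i+1},p_{i+2}$ are pairwise distinct for every $i$; it is closed if $M=\mathrm{Id}$. Vertices are identified with affine coordinates $p_i\in F$. $\mathrm{PGL}_2$ acts on the space $\tilde{\mathcal T}_n$ of $n$-gons by $A\cdot P=((Ap_i),AMA^{-1})$, with quotient (moduli space) $\mathcal T_n$ and class $[P]$. A polygonal transformation is a birational map $T:\tilde{\mathcal T}_n\dashrightarrow\tilde{\mathcal T}_n$ commuting with this action; it induces a birational map of $\mathcal T_n$, also denoted $T$. The cross-ratio coordinates of $P$ are the $n$-periodic sequence $c_i=\frac{p_i-p_{i-1}}{p_i-p_{i+2}}\cdot\frac{p_{i+1}-p_{i+2}}{p_{i+1}-p_{i-1}}$, which determines $[P]$. A scaling symmetry is a non-trivial action $\rho:\mathbb{G}_m\times\mathcal T_n\to\mathcal T_n$, $(t,[P])\mapsto[P]_t$, of the algebraic group $\mathbb{G}_m$ (rational in $t$ and the $c_i$, undefined where the deformed polygon degenerates) commuting with $T$; $c_i(t)$ denotes the cross-ratio coordinates of $[P]_t$ and $'$ the derivative in $t$. It is linear if $c_i(t)=c_i(1)+c_i'(1)(t-1)$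 for all $i$. $M(t)$ is the monodromy of a lift $P_t$ of $[P]_t$ (with $P_1=P$). Up to conjugation it is represented by the matrix $L_1(t)\cdots L_n(t)$, $L_i(t)=\begin{pmatrix}0&c_i(t)\\-1&1\end{pmatrix}$, rescaled by a constant so that $M(1)=\mathrm{Id}$ as a matrix (possible since $P$ is closed).
   Formalization: The factor 1/k! in the trace formula is dropped (the printed formula fails for k ≥ 2), and T is assumed to preserve the monodromy matrix product up to conjugation and a scalar constant along scaling orbits, without which the G_k need not be preserved. *)

theory Defs
  imports
    "HOL-Analysis.Analysis"
    "HOL-Computational_Algebra.Polynomial"
    "HOL-Library.Poly_Mapping"
begin

section \<open>The projective line and \<open>PGL\<^sub>2\<close>\<close>

datatype 'k proj_line = Aff 'k | Infty

fun hx :: "'k::field proj_line \<Rightarrow> 'k" where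
  "hx (Aff x) = x"
| "hx Infty = 1"

fun hy :: "'k::field proj_line \<Rightarrow> 'k" where
  "hy (Aff x) = 1"
| "hy Infty = 0"

definition mk_point :: "'k::field \<Rightarrow> 'k \<Rightarrow> 'k proj_line" where
  "mk_point x y = (if y = 0 then Infty else Aff (x / y))"

text \<open>The difference of two affine coordinates, as the determinant of homogeneous
  coordinate vectors. In all the quotients below every vertex has the same degree in
  the numerator and in the denominator, so they do not depend on the choice of these vectors, and
  this is the usual convention by which factors containing \<open>\<infinity>\<close> cancel.\<close>

definition pdiff :: "'k::field proj_line \<Rightarrow> 'k proj_line \<Rightarrow> 'k" where
  "pdiff p q = hx p * hy q - hx q * hy p"

lemma pdiff_Aff [simp]: "pdiff (Aff x) (Aff y) = x - y"
  by (simp add: pdiff_def)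

definition proportional :: "'k::field^2^2 \<Rightarrow> 'k^2^2 \<Rightarrow> bool" where
  "proportional A B \<longleftrightarrow>
     det A \<noteq> 0 \<and> det B \<noteq> 0 \<and> (\<exists>s. s \<noteq> 0 \<and> B = mat s ** A)"

lemma mat_mult_entry: "(mat s ** A) $ i $ j = s * A $ i $ j"
  for A :: "'k::field^2^2"
proof -
  have "(\<Sum>k\<in>UNIV. (if i = k then s else 0) * A $ k $ j)
      = (\<Sum>k\<in>UNIV. if i = k then s * A $ k $ j else 0)"
    by (intro sum.cong) auto
  then show ?thesis
    by (simp add: matrix_matrix_mult_def mat_def)
qed

lemma mat_commute: "mat s ** A = A ** mat s" for A :: "'k::field^2^2"
proof -
  have "(\<Sum>k\<in>UNIV. A $ i $ k * (if k = j then s else 0))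
      = (\<Sum>k\<in>UNIV. if k = j then A $ i $ k * s else 0)" for i j :: 2
    by (intro sum.cong) auto
  then have "(A ** mat s) $ i $ j = s * A $ i $ j" for i j
    by (simp add: matrix_matrix_mult_def mat_def mult.commute)
  then show ?thesis
    by (simp add: vec_eq_iff mat_mult_entry)
qed

lemma mat_left_commute: "A ** (mat s ** B) = mat s ** (A ** B)" for A B :: "'k::field^2^2"
  by (metis mat_commute matrix_mul_assoc)

lemma mat_mult_mat_left: "mat s ** (mat t ** A) = mat (s * t) ** A" for A :: "'k::field^2^2"
  by (simp add: vec_eq_iff mat_mult_entry mult.assoc)

quotient_type (overloaded) 'k pgl2 = "'k::field^2^2" / partial: proportional
proof (rule part_equivpI)
  show "\<exists>A :: 'k^2^2. proportional A A"
    unfolding proportional_def by (intro exI[of _ "mat 1"] conjI exI[of _ 1]) (simp_all add: det_I)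
  show "symp (proportional :: 'k^2^2 \<Rightarrow> _)"
  proof (rule sympI)
    fix A B :: "'k^2^2" assume "proportional A B"
    then obtain s where s: "det A \<noteq> 0" "det B \<noteq> 0" "s \<noteq> 0" "B = mat s ** A"
      unfolding proportional_def by blast
    then have "A = mat (1 / s) ** B"
      by (simp add: mat_mult_mat_left)
    moreover have "1 / s \<noteq> 0"
      using s by simp
    ultimately show "proportional B A"
      unfolding proportional_def using s by blast
  qed
  show "transp (proportional :: 'k^2^2 \<Rightarrow> _)"
  proof (rule transpI)
    fix A B C :: "'k^2^2" assume "proportional A B" "proportional B C"
    then obtain s t where st: "det A \<noteq> 0" "det C \<noteq> 0" "s \<noteq> 0" "t \<noteq> 0" "B = mat s ** A" "C = mat t ** B"
      unfolding proportional_def by blast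
    then have "C = mat (t * s) ** A" "t * s \<noteq> 0"
      by (simp_all add: mat_mult_mat_left)
    with st(1,2) show "proportional A C"
      unfolding proportional_def by blast
  qed
qed

lift_definition pgl_one :: "'k::field pgl2" is "mat 1"
  unfolding proportional_def by (intro conjI exI[of _ 1]) (simp_all add: det_I)

lift_definition pgl_mult :: "'k::field pgl2 \<Rightarrow> 'k pgl2 \<Rightarrow> 'k pgl2" is "(**)"
proof -
  fix A A' B B' :: "'k^2^2"
  assume "proportional A A'" "proportional B B'"
  then obtain s t where st: "det A \<noteq> 0" "det A' \<noteq> 0" "det B \<noteq> 0" "det B' \<noteq> 0" "s \<noteq> 0" "t \<noteq> 0"
    and eq: "A' = mat s ** A" "B' = mat t ** B"
    unfolding proportional_def by blast
  have "A' ** B' = mat s ** (A ** (mat t ** B))"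
    by (simp only: eq matrix_mul_assoc[symmetric])
  also have "\<dots> = mat (s * t) ** (A ** B)"
    by (simp only: mat_left_commute[of A] mat_mult_mat_left)
  finally have "A' ** B' = mat (s * t) ** (A ** B)" .
  moreover have "det (A ** B) \<noteq> 0" "det (A' ** B') \<noteq> 0" "s * t \<noteq> 0"
    using st by (simp_all add: det_mul)
  ultimately show "proportional (A ** B) (A' ** B')"
    unfolding proportional_def by blast
qed

lift_definition pgl_inverse :: "'k::field pgl2 \<Rightarrow> 'k pgl2" is matrix_inv
proof -
  fix A A' :: "'k^2^2"
  assume "proportional A A'"
  then obtain s where s: "det A \<noteq> 0" "det A' \<noteq> 0" "s \<noteq> 0" and eq: "A' = mat s ** A"
    unfolding proportional_def by blast
  have inv_props: "B ** matrix_inv B = mat 1 \<and> matrix_inv B ** B = mat 1"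
    if "det B \<noteq> 0" for B :: "'k^2^2"
    using that unfolding invertible_det_nz[symmetric] invertible_def matrix_inv_def
    by (rule someI_ex)
  then have inv: "A ** matrix_inv A = mat 1" "A' ** matrix_inv A' = mat 1" "matrix_inv A' ** A' = mat 1"
    using s by blast+
  have "A' ** (mat (1 / s) ** matrix_inv A) = mat s ** (A ** (mat (1 / s) ** matrix_inv A))"
    by (simp only: eq matrix_mul_assoc[symmetric])
  also have "\<dots> = mat (s * (1 / s)) ** mat 1"
    by (simp only: mat_left_commute[of A] mat_mult_mat_left inv)
  also have "\<dots> = mat 1"
    using s by simp
  finally have "matrix_inv A' ** A' ** (mat (1 / s) ** matrix_inv A) = matrix_inv A'"
    by (simp add: matrix_mul_assoc[symmetric])
  then have "matrix_inv A' = mat (1 / s) ** matrix_inv A"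
    by (simp add: inv)
  moreover have "det A * det (matrix_inv A) = 1" "det A' * det (matrix_inv A') = 1"
    using inv by (simp_all only: det_mul[symmetric] det_I)
  then have "det (matrix_inv A) \<noteq> 0" "det (matrix_inv A') \<noteq> 0"
    by fastforce+
  moreover have "1 / s \<noteq> 0"
    using s by simp
  ultimately show "proportional (matrix_inv A) (matrix_inv A')"
    unfolding proportional_def by blast
qed

lift_definition pgl_act :: "'k::field pgl2 \<Rightarrow> 'k proj_line \<Rightarrow> 'k proj_line" is
  "\<lambda>A p. mk_point (A $ 1 $ 1 * hx p + A $ 1 $ 2 * hy p) (A $ 2 $ 1 * hx p + A $ 2 $ 2 * hy p)"
proof -
  fix A A' :: "'k^2^2"
  assume "proportional A A'"
  then obtain s where s: "s \<noteq> 0" and eq: "A' = mat s ** A"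
    unfolding proportional_def by blast
  have scale: "mk_point (s * x) (s * y) = mk_point x y" for x y
    using s by (simp add: mk_point_def)
  show "(\<lambda>p. mk_point (A $ 1 $ 1 * hx p + A $ 1 $ 2 * hy p) (A $ 2 $ 1 * hx p + A $ 2 $ 2 * hy p))
    = (\<lambda>p. mk_point (A' $ 1 $ 1 * hx p + A' $ 1 $ 2 * hy p) (A' $ 2 $ 1 * hx p + A' $ 2 $ 2 * hy p))"
    by (simp only: eq mat_mult_entry mult.assoc distrib_left[symmetric] scale)
qed


section \<open>Polygons and their classes\<close>

type_synonym 'k polygon = "(int \<Rightarrow> 'k proj_line) \<times> 'k pgl2"

definition ngons :: "nat \<Rightarrow> 'k::field polygon set" where
  "ngons n = {(p, M).
     (\<forall>i. p (i + int n) = pgl_act M (p i)) \<and>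
     (\<forall>i. p i \<noteq> p (i + 1) \<and> p (i + 1) \<noteq> p (i + 2) \<and> p i \<noteq> p (i + 2))}"

definition closed_polygon :: "'k::field polygon \<Rightarrow> bool" where
  "closed_polygon P \<longleftrightarrow> snd P = pgl_one"

definition act :: "'k::field pgl2 \<Rightarrow> 'k polygon \<Rightarrow> 'k polygon" where
  "act A P = ((\<lambda>i. pgl_act A (fst P i)), pgl_mult (pgl_mult A (snd P)) (pgl_inverse A))"

definition cls :: "'k::field polygon \<Rightarrow> 'k polygon set" where
  "cls P = {act A P | A. True}"

definition moduli :: "nat \<Rightarrow> 'k::field polygon set set" where
  "moduli n = cls ` ngons n"

definition cross_ratio :: "'k::field polygon \<Rightarrow> int \<Rightarrow> 'k" where
  "cross_ratio P i = (let p = fst P in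
     (pdiff (p i) (p (i - 1)) / pdiff (p i) (p (i + 2))) *
     (pdiff (p (i + 1)) (p (i + 2)) / pdiff (p (i + 1)) (p (i - 1))))"

definition class_cr :: "'k::field polygon set \<Rightarrow> int \<Rightarrow> 'k" where
  "class_cr x i = (THE c. \<exists>P\<in>x. c = cross_ratio P i)"


section \<open>Rational maps\<close>

text \<open>The ground field \<open>F\<close> is a subfield of an infinite field \<open>'k\<close> (one may
  take \<open>F = UNIV\<close> if the ground field is infinite, and the rational function field over the
  ground field in general). Varieties over \<open>F\<close> are
  represented by their \<open>'k\<close>-points; since \<open>'k\<close> is infinite, identities between rational maps
  can be tested on \<open>'k\<close>-points. This makes rational maps, identities between
  them, and formal derivatives meaningful over finite ground fields as well.\<close>

definition is_subfield :: "'k::field set \<Rightarrow> bool" where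
  "is_subfield F \<longleftrightarrow> 0 \<in> F \<and> 1 \<in> F \<and>
     (\<forall>x\<in>F. \<forall>y\<in>F. x - y \<in> F \<and> x * y \<in> F \<and> inverse x \<in> F)"

text \<open>Polynomials in variables indexed by \<open>nat\<close>: a monomial is its exponent
  vector.\<close>

type_synonym 'k mpoly = "(nat \<Rightarrow>\<^sub>0 nat) \<Rightarrow>\<^sub>0 'k"

definition mpoly_eval :: "'k::field mpoly \<Rightarrow> (nat \<Rightarrow> 'k) \<Rightarrow> 'k" where
  "mpoly_eval f \<xi> = (\<Sum>m\<in>Poly_Mapping.keys f.
     Poly_Mapping.lookup f m * (\<Prod>j\<in>Poly_Mapping.keys m. \<xi> j ^ Poly_Mapping.lookup m j))"

text \<open>A variety is given by the relation \<open>X x \<xi>\<close>: \<open>\<xi>\<close> is a vector of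
  (multi)homogeneous coordinates of the point \<open>x\<close>; coordinates not mentioned in the relation are
  arbitrary. A rational map is a morphism defined on a nonempty open
  subset, its domain: around each point \<open>x\<close> of the domain it is given by polynomials \<open>f\<close> in these
  coordinates, and it is defined wherever \<open>f\<close> yields a point of the target. The
  last clause makes the domain Zariski open and the value independent of the choice of \<open>\<xi>\<close>.\<close>

definition rational_map ::
  "'k::field set \<Rightarrow> ('x \<Rightarrow> (nat \<Rightarrow> 'k) \<Rightarrow> bool) \<Rightarrow> ('y \<Rightarrow> (nat \<Rightarrow> 'k) \<Rightarrow> bool) \<Rightarrow> ('x \<Rightarrow> 'y option) \<Rightarrow> bool" where
  "rational_map F X Y \<phi> \<longleftrightarrow>
     (\<exists>x. \<phi> x \<noteq> None) \<and>
     (\<forall>x y. \<phi> x = Some y \<longrightarrow>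
        (\<exists>f :: nat \<Rightarrow> 'k mpoly.
           (\<forall>j m. Poly_Mapping.lookup (f j) m \<in> F) \<and>
           (\<exists>\<xi>. X x \<xi> \<and> Y y (\<lambda>j. mpoly_eval (f j) \<xi>)) \<and>
           (\<forall>x' \<xi> y'. X x' \<xi> \<and> Y y' (\<lambda>j. mpoly_eval (f j) \<xi>) \<longrightarrow> \<phi> x' = Some y')))"

definition birational_map ::
  "'k::field set \<Rightarrow> ('x \<Rightarrow> (nat \<Rightarrow> 'k) \<Rightarrow> bool) \<Rightarrow> ('y \<Rightarrow> (nat \<Rightarrow> 'k) \<Rightarrow> bool) \<Rightarrow> ('x \<Rightarrow> 'y option) \<Rightarrow> bool" where
  "birational_map F X Y \<phi> \<longleftrightarrow> rational_map F X Y \<phi> \<and>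
     (\<exists>\<psi>. rational_map F Y X \<psi> \<and>
       (\<exists>x y. \<phi> x = Some y \<and> \<psi> y \<noteq> None) \<and> (\<exists>x y. \<psi> y = Some x \<and> \<phi> x \<noteq> None) \<and>
       (\<forall>x y x'. \<phi> x = Some y \<and> \<psi> y = Some x' \<longrightarrow> x' = x) \<and>
       (\<forall>x y y'. \<psi> y = Some x \<and> \<phi> x = Some y' \<longrightarrow> y' = y))"

text \<open>The space of \<open>n\<close>-gons as an open subset of \<open>(P\<^sup>1)\<^sup>n \<times> PGL\<^sub>2\<close>, where \<open>PGL\<^sub>2\<close> is open in
  \<open>P\<^sup>3\<close>: an \<open>n\<close>-gon is determined by \<open>n\<close> consecutive vertices and its monodromy.\<close>

definition ngon_coords :: "nat \<Rightarrow> 'k::field polygon \<Rightarrow> (nat \<Rightarrow> 'k) \<Rightarrow> bool" where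
  "ngon_coords n P \<xi> \<longleftrightarrow> P \<in> ngons n \<and>
     (\<forall>i<n. (\<xi> (2 * i), \<xi> (2 * i + 1)) \<noteq> (0, 0) \<and>
        fst P (int i) = mk_point (\<xi> (2 * i)) (\<xi> (2 * i + 1))) \<and>
     (let A = vector [vector [\<xi> (2 * n), \<xi> (2 * n + 1)], vector [\<xi> (2 * n + 2), \<xi> (2 * n + 3)]]
      in det A \<noteq> 0 \<and> snd P = abs_pgl2 A)"

text \<open>Cross-ratios of \<open>n\<close>-gons range over all nonzero values, so the moduli space is the open
  subset of \<open>P\<^sup>n\<close> with homogeneous coordinates \<open>1 : c\<^sub>1 : \<dots> : c\<^sub>n\<close>, \<open>c\<^sub>i \<noteq> 0\<close>.\<close>

definition moduli_coords :: "nat \<Rightarrow> 'k::field polygon set \<Rightarrow> (nat \<Rightarrow> 'k) \<Rightarrow> bool" where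
  "moduli_coords n x \<xi> \<longleftrightarrow> x \<in> moduli n \<and> \<xi> 0 \<noteq> 0 \<and>
     (\<forall>i\<in>{1..n}. \<xi> i = class_cr x (int i) * \<xi> 0)"

definition Gm_moduli_coords :: "nat \<Rightarrow> 'k::field \<times> 'k polygon set \<Rightarrow> (nat \<Rightarrow> 'k) \<Rightarrow> bool" where
  "Gm_moduli_coords n = (\<lambda>(t, x) \<xi>. moduli_coords n x \<xi> \<and> t \<noteq> 0 \<and> \<xi> (n + 1) = t * \<xi> 0)"


section \<open>Polygonal transformations and scaling symmetries\<close>

definition polygonal_transformation ::
  "'k::field set \<Rightarrow> nat \<Rightarrow> ('k polygon \<Rightarrow> 'k polygon option) \<Rightarrow> bool" where
  "polygonal_transformation F n T \<longleftrightarrow>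
     birational_map F (ngon_coords n) (ngon_coords n) T \<and>
     (\<forall>A P Q R. T P = Some Q \<and> T (act A P) = Some R \<longrightarrow> R = act A Q)"

definition induced :: "('k::field polygon \<Rightarrow> 'k polygon option) \<Rightarrow> 'k polygon set \<Rightarrow> 'k polygon set \<Rightarrow> bool" where
  "induced T x y \<longleftrightarrow> (\<exists>P Q. T P = Some Q \<and> x = cls P \<and> y = cls Q)"

text \<open>A rational action: the axioms hold whenever both sides are defined, and
  the composites of the birational maps \<open>\<rho> s\<close> and \<open>\<rho> t\<close> are defined somewhere.\<close>

definition rational_Gm_action ::
  "'k::field set \<Rightarrow> nat \<Rightarrow> ('k \<Rightarrow> 'k polygon set \<Rightarrow> 'k polygon set option) \<Rightarrow> bool" where
  "rational_Gm_action F n \<rho> \<longleftrightarrow>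
     rational_map F (Gm_moduli_coords n) (moduli_coords n) (\<lambda>(t, x). \<rho> t x) \<and>
     (\<forall>x y. \<rho> 1 x = Some y \<longrightarrow> y = x) \<and>
     (\<forall>s t x y z w. \<rho> t x = Some y \<and> \<rho> s y = Some z \<and> \<rho> (s * t) x = Some w \<longrightarrow> z = w) \<and>
     (\<forall>s t. s \<noteq> 0 \<and> t \<noteq> 0 \<longrightarrow>
        (\<exists>x y. \<rho> t x = Some y \<and> \<rho> s y \<noteq> None \<and> \<rho> (s * t) x \<noteq> None))"

definition scaling_symmetry ::
  "'k::field set \<Rightarrow> nat \<Rightarrow> ('k polygon \<Rightarrow> 'k polygon option) \<Rightarrow>
   ('k \<Rightarrow> 'k polygon set \<Rightarrow> 'k polygon set option) \<Rightarrow> bool" where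
  "scaling_symmetry F n T \<rho> \<longleftrightarrow>
     rational_Gm_action F n \<rho> \<and>
     (\<exists>t x y. \<rho> t x = Some y \<and> y \<noteq> x) \<and>
     (\<forall>t x x\<^sub>t y y\<^sub>t z. induced T x y \<and> \<rho> t x = Some x\<^sub>t \<and> induced T x\<^sub>t z \<and> \<rho> t y = Some y\<^sub>t \<longrightarrow> z = y\<^sub>t)"

text \<open>Value and derivative at \<open>t\<close> of a rational function of one variable given by its values on
  a cofinite set. Derivatives are formal, so no topology on the field is involved.\<close>

definition rat_repr :: "('k::field \<Rightarrow> 'k option) \<Rightarrow> 'k poly \<Rightarrow> 'k poly \<Rightarrow> bool" where
  "rat_repr f N D \<longleftrightarrow> (\<forall>t v. f t = Some v \<and> poly D t \<noteq> 0 \<longrightarrow> v = poly N t / poly D t)"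

definition rat_value :: "('k::field \<Rightarrow> 'k option) \<Rightarrow> 'k \<Rightarrow> 'k" where
  "rat_value f t = (THE v. \<exists>N D. rat_repr f N D \<and> poly D t \<noteq> 0 \<and> v = poly N t / poly D t)"

definition rat_deriv :: "('k::field \<Rightarrow> 'k option) \<Rightarrow> 'k \<Rightarrow> 'k" where
  "rat_deriv f t = (THE d. \<exists>N D. rat_repr f N D \<and> poly D t \<noteq> 0 \<and>
     d = (poly (pderiv N) t * poly D t - poly N t * poly (pderiv D) t) / (poly D t)\<^sup>2)"

text \<open>The rational function \<open>t \<mapsto> c\<^sub>i(t)\<close> and its derivative; by continuation, \<open>c\<^sub>i(t)\<close> also makes
  sense at those \<open>t\<close> for which the deformed polygon degenerates.\<close>

definition cr_t :: "('k \<Rightarrow> 'k polygon set \<Rightarrow> 'k polygon set option) \<Rightarrow> 'k::field polygon \<Rightarrow> int \<Rightarrow> 'k \<Rightarrow> 'k" where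
  "cr_t \<rho> P i = rat_value (\<lambda>t. map_option (\<lambda>x. class_cr x i) (\<rho> t (cls P)))"

definition cr_t' :: "('k \<Rightarrow> 'k polygon set \<Rightarrow> 'k polygon set option) \<Rightarrow> 'k::field polygon \<Rightarrow> int \<Rightarrow> 'k \<Rightarrow> 'k" where
  "cr_t' \<rho> P i = rat_deriv (\<lambda>t. map_option (\<lambda>x. class_cr x i) (\<rho> t (cls P)))"

definition linear_scaling :: "nat \<Rightarrow> ('k \<Rightarrow> 'k::field polygon set \<Rightarrow> 'k polygon set option) \<Rightarrow> bool" where
  "linear_scaling n \<rho> \<longleftrightarrow>
     (\<forall>P\<in>ngons n. \<rho> 1 (cls P) \<noteq> None \<longrightarrow>
        (\<forall>i t. t \<noteq> 0 \<longrightarrow> cr_t \<rho> P i t = cr_t \<rho> P i 1 + cr_t' \<rho> P i 1 * (t - 1)))"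


section \<open>Monodromy\<close>

definition L_matrix :: "'k::field \<Rightarrow> 'k^2^2" where
  "L_matrix c = vector [vector [0, c], vector [- 1, 1]]"

primrec L_product :: "nat \<Rightarrow> (int \<Rightarrow> 'k::field) \<Rightarrow> 'k^2^2" where
  "L_product 0 c = mat 1"
| "L_product (Suc m) c = L_product m c ** L_matrix (c (int (Suc m)))"

text \<open>The matrix \<open>M(t)\<close>: the factor \<open>mat \<mu>\<close> is the rescaling by a constant for
  which \<open>M(1)\<close> is the identity matrix.\<close>

definition monodromy_t ::
  "nat \<Rightarrow> ('k \<Rightarrow> 'k polygon set \<Rightarrow> 'k polygon set option) \<Rightarrow> 'k::field polygon \<Rightarrow> 'k \<Rightarrow> 'k^2^2" where
  "monodromy_t n \<rho> P t =
     mat (THE \<mu>. mat \<mu> ** L_product n (\<lambda>i. cr_t \<rho> P i 1) = mat 1) **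
     L_product n (\<lambda>i. cr_t \<rho> P i t)"

text \<open>\<open>T\<close> preserves the monodromy, up to conjugation, as a matrix: \<open>L\<^sub>1\<cdots>L\<^sub>n\<close> is conjugated
  and multiplied by a factor that is constant along scaling orbits. Commuting
  with projective transformations does not imply this. Nor would it suffice to preserve the
  conjugacy class in \<open>PGL\<^sub>2\<close>: then \<open>M(t)\<close> could still be multiplied by a nonconstant
  function of \<open>t\<close>, which changes its trace.\<close>

definition preserves_monodromy ::
  "nat \<Rightarrow> ('k::field polygon \<Rightarrow> 'k polygon option) \<Rightarrow>
   ('k \<Rightarrow> 'k polygon set \<Rightarrow> 'k polygon set option) \<Rightarrow> bool" where
  "preserves_monodromy n T \<rho> \<longleftrightarrow>
     (\<exists>\<kappa>. (\<forall>x. \<kappa> x \<noteq> 0) \<and>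
       (\<forall>t x y. \<rho> t x = Some y \<longrightarrow> \<kappa> y = \<kappa> x) \<and>
       (\<forall>P Q. T P = Some Q \<longrightarrow>
          (\<exists>S. invertible S \<and>
             L_product n (cross_ratio Q) =
               mat (\<kappa> (cls P)) ** (S ** L_product n (cross_ratio P) ** matrix_inv S))))"


section \<open>The quantities \<open>G\<^sub>k\<close>\<close>

text \<open>Expanding \<open>L\<^sub>1(t)\<cdots>L\<^sub>n(t)\<close> in powers of \<open>t - 1\<close> produces each index set
  \<open>i\<^sub>1 < \<dots> < i\<^sub>k\<close> once, so \<open>G\<^sub>k\<close> is the coefficient of \<open>(t - 1)\<^sup>k\<close> in the trace of
  \<open>M(t)\<close>, and \<open>k! G\<^sub>k\<close> is the \<open>k\<close>-th derivative of the trace at \<open>1\<close>. The list \<open>is\<close> has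
  entries \<open>is ! 0 = i\<^sub>1\<close>, \<open>\<dots>\<close>, \<open>is ! (k - 1) = i\<^sub>k\<close>; \<open>(j + k - 1) mod k\<close> is the cyclic predecessor of \<open>j\<close>.\<close>

definition G :: "nat \<Rightarrow> ('k \<Rightarrow> 'k polygon set \<Rightarrow> 'k polygon set option) \<Rightarrow> 'k::field polygon \<Rightarrow> nat \<Rightarrow> 'k" where
  "G n \<rho> P k = (if k = 0 then 2 else
     (\<Sum>is\<in>{is :: int list. length is = k \<and> sorted_wrt (<) is \<and> set is \<subseteq> {1..int n}}.
        (\<Prod>j<k. cr_t' \<rho> P (is ! j) 1 / cr_t \<rho> P (is ! j) 1) *
        ((\<Prod>j<k. pdiff (fst P (is ! j)) (fst P (is ! ((j + k - 1) mod k) + 1))) /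
         (\<Prod>j<k. pdiff (fst P (is ! j)) (fst P (is ! j + 1))))))"

end

theory Submission
  imports Defs
begin

text \<open>Lift the vertices of a polygon to vectors \<open>q\<^sub>i\<close> in the plane. Their scaling can be chosen such that
  \<open>q\<^sub>i\<^sub>+\<^sub>2 = q\<^sub>i\<^sub>+\<^sub>1 - c\<^sub>i q\<^sub>i\<close> (\<open>recurrent_lift_exists\<close>), and then \<open>L\<^sub>i\<close> passes from the frame
  \<open>(-q\<^sub>i, q\<^sub>i\<^sub>+\<^sub>1)\<close> to the next one. If \<open>c\<^sub>i\<close> is replaced by \<open>c\<^sub>i + s d\<^sub>i\<close>, the transition acquires the factor
  \<open>1 + s (d\<^sub>i / c\<^sub>i) N\<^sub>i\<close>, where \<open>N\<^sub>i\<close> is the projection onto \<open>p\<^sub>i\<close> along \<open>p\<^sub>i\<^sub>+\<^sub>1\<close>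
  (\<open>frame_L_matrix\<close>). For a closed polygon the last frame is a multiple of the first, so with
  \<open>s = t - 1\<close> and \<open>d\<^sub>i = c\<^sub>i'(1)\<close> the matrix \<open>M(t)\<close> is conjugate to the product of these factors, and its
  trace is the sum over index sets of the traces of \<open>N\<^bsub>i\<^sub>1\<^esub> \<cdots> N\<^bsub>i\<^sub>k\<^esub>\<close>. The projections have rank one, so
  these traces are the cyclic products of differences that occur in \<open>G\<^sub>k\<close>
  (\<open>trace_projection_word\<close>). They vanish if two indices are cyclic neighbours, which cannot be
  avoided for \<open>k > n / 2\<close> (\<open>trace_coeff_eq_0\<close>). This proves the formula for the trace
  (\<open>L_product_closed\<close>).

  The field is infinite, so the \<open>G\<^sub>k\<close> are determined by the trace of \<open>M(t)\<close> at almost all \<open>t\<close>. Projective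
  invariance follows at once, because \<open>M(t)\<close> depends on the class of the polygon only. Invariance under
  \<open>T\<close> also reduces to a comparison of traces (\<open>G_preserved\<close>), but it needs polygons in the deformed classes
  at which \<open>T\<close> is defined. These are found by an algebraic version of continuity: the recurrence with coefficients
  \<open>c\<^sub>i + (t - 1) c\<^sub>i'(1)\<close> yields polygons with coordinates polynomial in \<open>t\<close>, one of which is \<open>P\<close>, and the
  domain of \<open>T\<close> is Zariski open (\<open>transformation_defined_along_family\<close>).
  That the formal functions \<open>c\<^sub>i(t)\<close> are the cross-ratios of the deformed classes is
  \<open>cr_t_eq_class_cr\<close>.\<close>

section \<open>Homographies of the projective line\<close>

lemma mk_point_hx_hy [simp]: "mk_point (hx p) (hy p) = p"
  by (cases p) (simp_all add: mk_point_def)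

lemma hx_hy_nonzero: "(hx p, hy p) \<noteq> (0, 0)"
  by (cases p) simp_all

lemma mk_point_scale:
  assumes "s \<noteq> 0"
  shows "mk_point (s * a) (s * b) = mk_point a b"
  using assms by (simp add: mk_point_def)

lemma hx_hy_mk_point:
  assumes "(a, b) \<noteq> (0, 0)"
  obtains s where "s \<noteq> 0" "a = s * hx (mk_point a b)" "b = s * hy (mk_point a b)"
proof (cases "b = 0")
  case True
  with assms show ?thesis by (intro that[of a]) (auto simp: mk_point_def)
next
  case False
  then show ?thesis by (intro that[of b]) (auto simp: mk_point_def)
qed

lemma pdiff_eq_0_iff: "pdiff p q = 0 \<longleftrightarrow> p = q"
  by (cases p; cases q) (auto simp: pdiff_def)

lemma pdiff_self [simp]: "pdiff p p = 0"
  by (simp add: pdiff_eq_0_iff)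

lemma mk_point_eq_iff:
  assumes "(a, b) \<noteq> (0, 0)" "(c, d) \<noteq> (0, 0)"
  shows "mk_point a b = mk_point c d \<longleftrightarrow> a * d - c * b = 0"
  using assms by (auto simp: mk_point_def divide_simps)

lemma mat2_image_nonzero:
  fixes A :: "'k::field^2^2"
  assumes "det A \<noteq> 0" "(a, b) \<noteq> (0, 0)"
  shows "(A $ 1 $ 1 * a + A $ 1 $ 2 * b, A $ 2 $ 1 * a + A $ 2 $ 2 * b) \<noteq> (0, 0)"
proof
  assume "(A $ 1 $ 1 * a + A $ 1 $ 2 * b, A $ 2 $ 1 * a + A $ 2 $ 2 * b) = (0, 0)"
  then have e: "A $ 1 $ 1 * a + A $ 1 $ 2 * b = 0" "A $ 2 $ 1 * a + A $ 2 $ 2 * b = 0"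
    by auto
  have "det A * a = A $ 2 $ 2 * (A $ 1 $ 1 * a + A $ 1 $ 2 * b) - A $ 1 $ 2 * (A $ 2 $ 1 * a + A $ 2 $ 2 * b)"
    "det A * b = A $ 1 $ 1 * (A $ 2 $ 1 * a + A $ 2 $ 2 * b) - A $ 2 $ 1 * (A $ 1 $ 1 * a + A $ 1 $ 2 * b)"
    by (simp_all add: det_2 algebra_simps)
  with e assms show False by auto
qed

lemma proportional_refl: "det A \<noteq> 0 \<Longrightarrow> proportional A A"
  unfolding proportional_def by (auto intro: exI[of _ 1])

lemma pgl_cases:
  fixes M :: "'k::field pgl2"
  obtains A where "det A \<noteq> 0" "M = abs_pgl2 A"
proof -
  have "proportional (rep_pgl2 M) (rep_pgl2 M)"
    using Quotient_pgl2 by (rule Quotient_rep_reflp)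
  moreover have "abs_pgl2 (rep_pgl2 M) = M"
    using Quotient_pgl2 by (rule Quotient_abs_rep)
  ultimately show ?thesis using that unfolding proportional_def by metis
qed

lemma abs_pgl2_eqD:
  assumes "det A \<noteq> 0" "det B \<noteq> 0" "abs_pgl2 A = abs_pgl2 B"
  obtains s where "s \<noteq> 0" "B = mat s ** A"
proof -
  have "proportional A B"
    using Quotient_pgl2 proportional_refl[OF assms(1)] proportional_refl[OF assms(2)] assms(3)
    by (metis Quotient_rel)
  with that show ?thesis by (auto simp: proportional_def)
qed

lemma abs_pgl2_scale:
  assumes "det A \<noteq> 0" "s \<noteq> 0"
  shows "det (mat s ** A) \<noteq> 0" "abs_pgl2 (mat s ** A) = abs_pgl2 (A :: 'k::field^2^2)"
proof -
  have "det (mat s ** A) = s * s * det A"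
    unfolding det_2 mat_mult_entry by (simp add: algebra_simps)
  with assms show "det (mat s ** A) \<noteq> 0" by simp
  with assms have "proportional A (mat s ** A)" by (auto simp: proportional_def)
  then show "abs_pgl2 (mat s ** A) = abs_pgl2 A"
    using Quotient_pgl2 by (metis Quotient_rel)
qed

text \<open>The action is defined through the normalised coordinates \<open>hx\<close>, \<open>hy\<close>; this form for arbitrary
  homogeneous coordinates is the one that can be iterated.\<close>

lemma pgl_act_mk_point:
  assumes "det A \<noteq> 0" "(a, b) \<noteq> (0, 0)"
  shows "pgl_act (abs_pgl2 A) (mk_point a b) =
    mk_point (A $ 1 $ 1 * a + A $ 1 $ 2 * b) (A $ 2 $ 1 * a + A $ 2 $ 2 * b)"
proof -
  define p where "p = mk_point a b"
  obtain s where s: "s \<noteq> 0" "a = s * hx p" "b = s * hy p"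
    using hx_hy_mk_point[OF assms(2)] unfolding p_def .
  have "mk_point (A $ 1 $ 1 * a + A $ 1 $ 2 * b) (A $ 2 $ 1 * a + A $ 2 $ 2 * b) =
     mk_point (s * (A $ 1 $ 1 * hx p + A $ 1 $ 2 * hy p)) (s * (A $ 2 $ 1 * hx p + A $ 2 $ 2 * hy p))"
    by (simp add: s(2,3) algebra_simps)
  with s show ?thesis
    by (simp add: mk_point_scale pgl_act.abs_eq[OF proportional_refl[OF assms(1)]] flip: p_def)
qed

lemma mat2_mult_nth:
  fixes A B :: "'k::field^2^2"
  shows "(A ** B) $ i $ j = A $ i $ 1 * B $ 1 $ j + A $ i $ 2 * B $ 2 $ j"
  by (simp add: matrix_matrix_mult_def sum_2)

lemma pgl_act_mult: "pgl_act (pgl_mult A B) p = pgl_act A (pgl_act B p)"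
proof -
  obtain A' where A: "det A' \<noteq> 0" "A = abs_pgl2 A'" by (rule pgl_cases)
  obtain B' where B: "det B' \<noteq> 0" "B = abs_pgl2 B'" by (rule pgl_cases)
  have "det (A' ** B') \<noteq> 0" using A B by (simp add: det_mul)
  moreover have "pgl_mult A B = abs_pgl2 (A' ** B')"
    using A B by (simp add: pgl_mult.abs_eq proportional_refl)
  moreover obtain a b where p: "p = mk_point a b" "(a, b) \<noteq> (0, 0)"
    using hx_hy_nonzero[of p] by (metis mk_point_hx_hy)
  moreover have "pgl_act B p = mk_point (B' $ 1 $ 1 * a + B' $ 1 $ 2 * b) (B' $ 2 $ 1 * a + B' $ 2 $ 2 * b)"
    unfolding B(2) p(1) by (rule pgl_act_mk_point[OF B(1) p(2)])
  ultimately show ?thesis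
    using A B p pgl_act_mk_point[OF A(1) mat2_image_nonzero[OF B(1) p(2)]]
    by (simp only: pgl_act_mk_point) (simp add: mat2_mult_nth algebra_simps)
qed

lemma pgl_act_one [simp]: "pgl_act pgl_one p = p"
proof -
  have "det (mat 1 :: 'a^2^2) \<noteq> 0" by (simp add: det_I)
  from pgl_act_mk_point[OF this hx_hy_nonzero[of p]] show ?thesis
    by (simp add: pgl_one_def mat_def)
qed

text \<open>A nonzero binary quadratic form has at most two zeros on the projective line. A zero at infinity
  removes the leading coefficient and leaves a linear form with two affine zeros.\<close>

lemma binary_quadratic_form_eq_0:
  fixes \<alpha> \<beta> \<gamma> :: "'k::field"
  assumes "distinct [p, q, r]"
    and "\<forall>z \<in> {p, q, r}. \<alpha> * hx z * hx z + \<beta> * hx z * hy z + \<gamma> * hy z * hy z = 0"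
  shows "\<alpha> = 0 \<and> \<beta> = 0 \<and> \<gamma> = 0"
proof -
  have lin: "b = 0 \<and> c = 0" if "b * x + c = 0" "b * y + c = 0" "x \<noteq> y" for b c x y :: 'k
  proof -
    have "b * (x - y) = (b * x + c) - (b * y + c)" by (simp add: algebra_simps)
    with that show ?thesis by auto
  qed
  have quad: "\<alpha> = 0 \<and> \<beta> = 0 \<and> \<gamma> = 0"
    if "\<alpha> * x * x + \<beta> * x + \<gamma> = 0" "\<alpha> * y * y + \<beta> * y + \<gamma> = 0" "\<alpha> * z * z + \<beta> * z + \<gamma> = 0"
      "x \<noteq> y" "x \<noteq> z" "y \<noteq> z" for x y z
  proof -
    have "(x - y) * (\<alpha> * (x + y) + \<beta>) = (\<alpha> * x * x + \<beta> * x + \<gamma>) - (\<alpha> * y * y + \<beta> * y + \<gamma>)"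
      "(x - z) * (\<alpha> * (x + z) + \<beta>) = (\<alpha> * x * x + \<beta> * x + \<gamma>) - (\<alpha> * z * z + \<beta> * z + \<gamma>)"
      by (simp_all add: algebra_simps)
    with that have "\<alpha> * (x + y) + \<beta> = 0" "\<alpha> * (x + z) + \<beta> = 0" by auto
    with lin[of \<alpha> "x + y" \<beta> "x + z"] that show ?thesis by auto
  qed
  consider "p = Infty" | "q = Infty" | "r = Infty" | x y z where "p = Aff x" "q = Aff y" "r = Aff z"
    by (cases p; cases q; cases r) auto
  then show ?thesis
  proof cases
    case 1
    with assms obtain y z where "q = Aff y" "r = Aff z" by (cases q; cases r) auto
    with 1 assms lin[of \<beta> y \<gamma> z] show ?thesis by auto
  next
    case 2
    with assms obtain y z where "p = Aff y" "r = Aff z" by (cases p; cases r) auto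
    with 2 assms lin[of \<beta> y \<gamma> z] show ?thesis by auto
  next
    case 3
    with assms obtain y z where "p = Aff y" "q = Aff z" by (cases p; cases q) auto
    with 3 assms lin[of \<beta> y \<gamma> z] show ?thesis by auto
  next
    case 4
    with assms show ?thesis by (intro quad[of x y z]) auto
  qed
qed

lemma parallel_imp_scaled:
  fixes a b c d :: "'k::field"
  assumes "(a, b) \<noteq> (0, 0)" "(c, d) \<noteq> (0, 0)" "a * d = b * c"
  obtains s where "s \<noteq> 0" "c = s * a" "d = s * b"
proof (cases "a = 0")
  case True
  with assms show ?thesis by (intro that[of "d / b"]) auto
next
  case False
  with assms show ?thesis by (intro that[of "c / a"]) (auto simp: field_simps)
qed

text \<open>Three points determine a homography. For matrices \<open>A\<close> and \<open>B\<close>, the determinant of \<open>A v\<close> and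
  \<open>B v\<close> is a quadratic form in \<open>v\<close>, and it has three zeros, so its coefficients vanish. The
  outer two say that the columns of \<open>B\<close> are multiples of those of \<open>A\<close>, and the middle one that the
  two factors are equal.\<close>

lemma pgl_eqI_three_points:
  fixes M N :: "'k::field pgl2"
  assumes "distinct [p, q, r]" "\<forall>z \<in> {p, q, r}. pgl_act M z = pgl_act N z"
  shows "M = N"
proof -
  obtain A where A: "det A \<noteq> 0" "M = abs_pgl2 A" by (rule pgl_cases)
  obtain B where B: "det B \<noteq> 0" "N = abs_pgl2 B" by (rule pgl_cases)
  define \<alpha> where "\<alpha> = A $ 1 $ 1 * B $ 2 $ 1 - B $ 1 $ 1 * A $ 2 $ 1"
  define \<beta> where "\<beta> = A $ 1 $ 1 * B $ 2 $ 2 + A $ 1 $ 2 * B $ 2 $ 1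
    - (B $ 1 $ 1 * A $ 2 $ 2 + B $ 1 $ 2 * A $ 2 $ 1)"
  define \<gamma> where "\<gamma> = A $ 1 $ 2 * B $ 2 $ 2 - B $ 1 $ 2 * A $ 2 $ 2"
  have "\<forall>z \<in> {p, q, r}. \<alpha> * hx z * hx z + \<beta> * hx z * hy z + \<gamma> * hy z * hy z = 0"
  proof
    fix z assume "z \<in> {p, q, r}"
    with assms have "pgl_act M (mk_point (hx z) (hy z)) = pgl_act N (mk_point (hx z) (hy z))" by auto
    then show "\<alpha> * hx z * hx z + \<beta> * hx z * hy z + \<gamma> * hy z * hy z = 0"
      unfolding A(2) B(2) pgl_act_mk_point[OF A(1) hx_hy_nonzero] pgl_act_mk_point[OF B(1) hx_hy_nonzero]
        mk_point_eq_iff[OF mat2_image_nonzero[OF A(1) hx_hy_nonzero] mat2_image_nonzero[OF B(1) hx_hy_nonzero]]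
      by (simp add: \<alpha>_def \<beta>_def \<gamma>_def algebra_simps)
  qed
  from binary_quadratic_form_eq_0[OF assms(1) this] have z: "\<alpha> = 0" "\<beta> = 0" "\<gamma> = 0" by auto
  obtain s where s: "s \<noteq> 0" "B $ 1 $ 1 = s * A $ 1 $ 1" "B $ 2 $ 1 = s * A $ 2 $ 1"
    by (rule parallel_imp_scaled[of "A $ 1 $ 1" "A $ 2 $ 1" "B $ 1 $ 1" "B $ 2 $ 1"])
      (use A(1) B(1) z(1) in \<open>auto simp: det_2 \<alpha>_def algebra_simps\<close>)
  obtain t where t: "t \<noteq> 0" "B $ 1 $ 2 = t * A $ 1 $ 2" "B $ 2 $ 2 = t * A $ 2 $ 2"
    by (rule parallel_imp_scaled[of "A $ 1 $ 2" "A $ 2 $ 2" "B $ 1 $ 2" "B $ 2 $ 2"])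
      (use A(1) B(1) z(3) in \<open>auto simp: det_2 \<gamma>_def algebra_simps\<close>)
  have "(t - s) * det A = \<beta>" by (simp add: det_2 \<beta>_def s t algebra_simps)
  with A z have "t = s" by simp
  then have "B = mat s ** A"
    by (simp add: vec_eq_iff forall_2 mat_mult_entry s t)
  with A B s have "proportional A B" by (auto simp: proportional_def)
  then show ?thesis unfolding A(2) B(2)
    using Quotient_pgl2 by (metis Quotient_rel)
qed

lemma pgl_eqI:
  assumes "\<And>p. pgl_act M p = pgl_act N p"
  shows "M = N"
  by (rule pgl_eqI_three_points[of "Aff 0" "Aff 1" Infty]) (use assms in auto)

lemma matrix_inv_cancel:
  fixes B :: "'a::semiring_1^'n^'m"
  assumes "invertible B"
  shows "B ** matrix_inv B = mat 1" "matrix_inv B ** B = mat 1"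
  using someI_ex[OF assms[unfolded invertible_def]] by (auto simp: matrix_inv_def)

lemma pgl_act_inverse: "pgl_act (pgl_inverse A) (pgl_act A p) = p" "pgl_act A (pgl_act (pgl_inverse A) p) = p"
proof -
  obtain B where B: "det B \<noteq> 0" "A = abs_pgl2 B" by (rule pgl_cases)
  then have inv: "matrix_inv B ** B = mat 1" "B ** matrix_inv B = mat 1"
    using matrix_inv_cancel[of B] by (simp_all add: invertible_det_nz)
  have d: "det (matrix_inv B) \<noteq> 0"
    using arg_cong[OF inv(1), of det] by (auto simp: det_mul det_I)
  have "pgl_mult (pgl_inverse A) A = pgl_one" "pgl_mult A (pgl_inverse A) = pgl_one"
    using B d by (simp_all add: pgl_inverse.abs_eq pgl_mult.abs_eq proportional_refl pgl_one_def inv)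
  then show "pgl_act (pgl_inverse A) (pgl_act A p) = p" "pgl_act A (pgl_act (pgl_inverse A) p) = p"
    by (simp_all flip: pgl_act_mult)
qed

lemma pgl_act_eq_iff [simp]: "pgl_act A p = pgl_act A q \<longleftrightarrow> p = q"
  by (metis pgl_act_inverse(1))

lemma pgl_act_inverse_mult:
  "pgl_act (pgl_inverse (pgl_mult A B)) p = pgl_act (pgl_inverse B) (pgl_act (pgl_inverse A) p)"
proof -
  have "pgl_act (pgl_mult A B) (pgl_act (pgl_inverse (pgl_mult A B)) p) =
      pgl_act (pgl_mult A B) (pgl_act (pgl_inverse B) (pgl_act (pgl_inverse A) p))"
    by (simp only: pgl_act_inverse) (simp only: pgl_act_mult pgl_act_inverse)
  then show ?thesis by simp
qed

lemma pgl_act_inverse_one [simp]: "pgl_act (pgl_inverse pgl_one) p = p"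
  using pgl_act_inverse(2)[of pgl_one p] by simp

lemma act_act: "act A (act B P) = act (pgl_mult A B) P"
proof -
  have "pgl_mult (pgl_mult A (pgl_mult (pgl_mult B M) (pgl_inverse B))) (pgl_inverse A)
      = pgl_mult (pgl_mult (pgl_mult A B) M) (pgl_inverse (pgl_mult A B))" for M
    by (rule pgl_eqI) (simp add: pgl_act_mult pgl_act_inverse_mult)
  then show ?thesis by (simp add: act_def pgl_act_mult)
qed

lemma act_one: "act pgl_one P = P"
proof -
  have "pgl_mult (pgl_mult pgl_one M) (pgl_inverse pgl_one) = M" for M
    by (rule pgl_eqI) (simp add: pgl_act_mult)
  then show ?thesis by (simp add: act_def fun_eq_iff prod_eq_iff)
qed

lemma act_inverse: "act (pgl_inverse A) (act A P) = P"
proof -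
  have "pgl_mult (pgl_inverse A) A = pgl_one"
    by (rule pgl_eqI) (simp add: pgl_act_mult pgl_act_inverse)
  then show ?thesis by (simp add: act_act act_one)
qed

lemma self_in_cls: "P \<in> cls P"
  unfolding cls_def using act_one[of P] by (metis (mono_tags, lifting) mem_Collect_eq)

lemma cls_act: "cls (act A P) = cls P"
proof -
  have "act B P = act (pgl_mult (pgl_mult B (pgl_inverse A)) A) P" for B
    by (simp only: act_inverse flip: act_act)
  then show ?thesis unfolding cls_def act_act by blast
qed

text \<open>A homography multiplies every \<open>pdiff p q\<close> by its determinant and by one factor for each of the
  two points. These factors cancel in cross-ratios.\<close>

lemma pdiff_pgl_act:
  obtains s \<Delta> where "\<And>p. s p \<noteq> 0" "\<Delta> \<noteq> 0"
    "\<And>p q. pdiff (pgl_act A p) (pgl_act A q) = \<Delta> * (s p * s q * pdiff p q)"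
proof -
  obtain B where B: "det B \<noteq> 0" "A = abs_pgl2 B" by (rule pgl_cases)
  define X where "X p = B $ 1 $ 1 * hx p + B $ 1 $ 2 * hy p" for p
  define Y where "Y p = B $ 2 $ 1 * hx p + B $ 2 $ 2 * hy p" for p
  have XY: "(X p, Y p) \<noteq> (0, 0)" for p
    unfolding X_def Y_def using mat2_image_nonzero[OF B(1) hx_hy_nonzero] .
  have act: "pgl_act A p = mk_point (X p) (Y p)" for p
    using pgl_act_mk_point[OF B(1) hx_hy_nonzero[of p]] by (simp add: B X_def Y_def)
  have "\<exists>s. s \<noteq> 0 \<and> X p = s * hx (pgl_act A p) \<and> Y p = s * hy (pgl_act A p)" for p
    using hx_hy_mk_point[OF XY[of p]] by (metis act)
  then obtain \<sigma> where \<sigma>: "\<And>p. \<sigma> p \<noteq> 0" "\<And>p. X p = \<sigma> p * hx (pgl_act A p)"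
    "\<And>p. Y p = \<sigma> p * hy (pgl_act A p)" by metis
  have "\<sigma> p * \<sigma> q * pdiff (pgl_act A p) (pgl_act A q) = X p * Y q - X q * Y p" for p q
    by (simp add: \<sigma> pdiff_def algebra_simps)
  moreover have "X p * Y q - X q * Y p = det B * pdiff p q" for p q
    by (simp add: X_def Y_def pdiff_def det_2 algebra_simps)
  ultimately have "pdiff (pgl_act A p) (pgl_act A q) = det B * (1 / \<sigma> p * (1 / \<sigma> q) * pdiff p q)" for p q
    using \<sigma>(1) by (simp add: field_simps)
  with \<sigma>(1) B(1) show ?thesis by (intro that[of "\<lambda>p. 1 / \<sigma> p" "det B"]) auto
qed

lemma cross_ratio_act: "cross_ratio (act A P) i = cross_ratio P i"
proof -
  obtain s \<Delta> where s: "\<And>p. s p \<noteq> 0" "\<Delta> \<noteq> 0"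
    "\<And>p q. pdiff (pgl_act A p) (pgl_act A q) = \<Delta> * (s p * s q * pdiff p q)"
    using pdiff_pgl_act[of A] by metis
  then show ?thesis
    by (simp add: cross_ratio_def act_def Let_def)
qed

lemma class_cr_cls [simp]: "class_cr (cls P) i = cross_ratio P i"
proof -
  have "\<exists>Q\<in>cls P. cross_ratio P i = cross_ratio Q i"
    using self_in_cls by blast
  moreover have "cross_ratio Q i = cross_ratio P i" if "Q \<in> cls P" for Q
    using that unfolding cls_def by (auto simp only: mem_Collect_eq cross_ratio_act)
  ultimately show ?thesis
    unfolding class_cr_def by (intro the_equality) auto
qed

lemma ngonsD:
  assumes "P \<in> ngons n"
  shows "fst P (i + int n) = pgl_act (snd P) (fst P i)"
    "fst P i \<noteq> fst P (i + 1)" "fst P i \<noteq> fst P (i + 2)"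
  using assms by (auto simp: ngons_def)

lemma act_in_ngons:
  assumes "P \<in> ngons n" shows "act A P \<in> ngons n"
  using assms by (auto simp: ngons_def act_def pgl_act_mult pgl_act_inverse)

lemma closed_act:
  assumes "closed_polygon P" shows "closed_polygon (act A P)"
proof -
  have "pgl_mult (pgl_mult A pgl_one) (pgl_inverse A) = pgl_one"
    by (rule pgl_eqI) (simp add: pgl_act_mult pgl_act_inverse)
  with assms show ?thesis by (simp add: closed_polygon_def act_def)
qed

lemma cross_ratio_nonzero:
  assumes "P \<in> ngons n" shows "cross_ratio P i \<noteq> 0"
  using ngonsD(2,3)[OF assms, of "i - 1"] ngonsD(2,3)[OF assms, of i] ngonsD(2,3)[OF assms, of "i + 1"]
  by (auto simp: cross_ratio_def Let_def pdiff_eq_0_iff add.commute)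

lemma cross_ratio_periodic:
  assumes "P \<in> ngons n" shows "cross_ratio P (i + int n) = cross_ratio P i"
proof -
  have "fst P (j + int n) = fst (act (snd P) P) j" for j
    using ngonsD[OF assms] by (simp add: act_def)
  from this[of i] this[of "i - 1"] this[of "i + 1"] this[of "i + 2"]
  have "cross_ratio P (i + int n) = cross_ratio (act (snd P) P) i"
    by (simp add: cross_ratio_def Let_def algebra_simps)
  then show ?thesis by (simp add: cross_ratio_act)
qed

text \<open>The vertices determine the monodromy, since it maps three distinct vertices to known ones.\<close>

lemma ngon_eqI:
  assumes "P \<in> ngons n" "Q \<in> ngons n" "fst P = fst Q"
  shows "P = Q"
proof -
  have "snd P = snd Q"
  proof (rule pgl_eqI_three_points[of "fst Q 0" "fst Q 1" "fst Q 2"])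
    show "distinct [fst Q 0, fst Q 1, fst Q 2]"
      using ngonsD(2,3)[OF assms(2), of 0] ngonsD(2)[OF assms(2), of 1] by simp
    show "\<forall>z\<in>{fst Q 0, fst Q 1, fst Q 2}. pgl_act (snd P) z = pgl_act (snd Q) z"
      using ngonsD(1)[OF assms(2)] ngonsD(1)[OF assms(1)] unfolding assms(3) by (metis empty_iff insert_iff)
  qed
  with assms(3) show ?thesis by (simp add: prod_eq_iff)
qed

section \<open>Cross-ratios as coefficients of a recurrence\<close>

text \<open>Surjectivity of the steps is what makes it possible to run a recurrence backwards to negative
  indices.\<close>

lemma int_recurrence_exists:
  assumes "\<And>i. surj (g i)"
  shows "\<exists>f :: int \<Rightarrow> 'a. f 0 = a \<and> (\<forall>i. f (i + 1) = g i (f i))"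
proof -
  define fwd where "fwd = rec_nat a (\<lambda>k. g (int k))"
  define bwd where "bwd = rec_nat a (\<lambda>k v. SOME u. g (- int k - 1) u = v)"
  have bwd: "g (- int k - 1) (bwd (Suc k)) = bwd k" for k
  proof -
    have "\<exists>u. g (- int k - 1) u = bwd k" using assms by (metis surjD)
    then show ?thesis unfolding bwd_def by (simp, rule someI_ex)
  qed
  define f where "f i = (if i \<ge> 0 then fwd (nat i) else bwd (nat (- i)))" for i
  have f: "f (i + 1) = g i (f i)" for i
  proof (cases "i \<ge> 0")
    case True
    then have "nat (i + 1) = Suc (nat i)" by simp
    with True show ?thesis by (simp add: f_def fwd_def)
  next
    case False
    define k where "k = nat (- i - 1)"
    have k: "i = - int k - 1" using False by (simp add: k_def)
    have "f (i + 1) = bwd k" by (auto simp: f_def k fwd_def bwd_def)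
    moreover have "f i = bwd (Suc k)" by (simp add: f_def k nat_add_distrib)
    ultimately show ?thesis using bwd[of k] k by simp
  qed
  have "f 0 = a" by (simp add: f_def fwd_def)
  with f show ?thesis by blast
qed

text \<open>The recurrence under which right multiplication by the matrix \<open>L(c\<^sub>i)\<close> maps the row
  \<open>(-x\<^sub>i, x\<^sub>i\<^sub>+\<^sub>1)\<close> to the next one. It is applied to both homogeneous coordinates of lifts \<open>q\<^sub>i = (x\<^sub>i, y\<^sub>i)\<close> of
  the vertices of a polygon.\<close>

definition recurrent :: "(int \<Rightarrow> 'k::field) \<Rightarrow> (int \<Rightarrow> 'k) \<Rightarrow> bool" where
  "recurrent c x \<longleftrightarrow> (\<forall>i. x (i + 2) = x (i + 1) - c i * x i)"

lemma recurrentD: "recurrent c x \<Longrightarrow> x (i + 2) = x (i + 1) - c i * x i"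
  by (simp add: recurrent_def)

lemma recurrent_exists:
  fixes c :: "int \<Rightarrow> 'k::field"
  assumes "\<And>i. c i \<noteq> 0"
  shows "\<exists>x. x 0 = a \<and> x 1 = b \<and> recurrent c x"
proof -
  define g where "g i = (\<lambda>(u, v). (v, v - c i * u))" for i
  have "g i ((fst w - snd w) / c i, fst w) = w" for i w
    using assms by (simp add: g_def)
  then have "surj (g i)" for i by (rule surjI)
  from int_recurrence_exists[of g, OF this, of "(a, b)"] obtain f where
    f: "f 0 = (a, b)" "\<And>i. f (i + 1) = g i (f i)" by blast
  define x where "x i = fst (f i)" for i
  have step: "fst (f (i + 1)) = snd (f i)" "snd (f (i + 1)) = snd (f i) - c i * fst (f i)" for i
    unfolding f(2) g_def by (simp_all add: split_beta)
  have "recurrent c x"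
    unfolding recurrent_def
  proof
    fix i
    have "x (i + 2) = snd (f (i + 1))" using step(1)[of "i + 1"] by (simp add: x_def add.assoc)
    also have "\<dots> = snd (f i) - c i * fst (f i)" by (rule step)
    also have "\<dots> = x (i + 1) - c i * x i" using step(1)[of i] by (simp add: x_def)
    finally show "x (i + 2) = x (i + 1) - c i * x i" .
  qed
  moreover have "x 0 = a" "x 1 = b" using f(1) step(1)[of 0] by (simp_all add: x_def)
  ultimately show ?thesis by blast
qed

lemma recurrent_unique:
  fixes c :: "int \<Rightarrow> 'k::field"
  assumes "\<And>i. c i \<noteq> 0" "recurrent c x" "recurrent c y" "x 0 = y 0" "x 1 = y 1"
  shows "x i = y i"
proof -
  have "x i = y i \<and> x (i + 1) = y (i + 1)"
  proof (induction i rule: int_induct[where k = 0])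
    case base
    then show ?case using assms by simp
  next
    case (step1 i)
    then show ?case using recurrentD[OF assms(2), of i] recurrentD[OF assms(3), of i] by (simp add: add.assoc)
  next
    case (step2 i)
    have e: "i - 1 + 2 = i + 1" "i - 1 + 1 = i" by simp_all
    have "x (i + 1) = x i - c (i - 1) * x (i - 1)" "y (i + 1) = y i - c (i - 1) * y (i - 1)"
      using recurrentD[OF assms(2), of "i - 1"] recurrentD[OF assms(3), of "i - 1"] by (simp_all only: e)
    then have "c (i - 1) * x (i - 1) = c (i - 1) * y (i - 1)"
      using step2(2) by auto
    with assms(1)[of "i - 1"] step2 show ?case by simp
  qed
  then show ?thesis by blast
qed

lemma recurrent_linear:
  assumes "recurrent c x" "recurrent c y"
  shows "recurrent c (\<lambda>i. \<alpha> * x i + \<beta> * y i)"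
  unfolding recurrent_def by (simp add: recurrentD[OF assms(1)] recurrentD[OF assms(2)] algebra_simps)

lemma recurrent_shift:
  assumes "recurrent c x" "\<And>i. c (i + m) = c i"
  shows "recurrent c (\<lambda>i. x (i + m))"
proof -
  have "x (i + 2 + m) = x (i + 1 + m) - c i * x (i + m)" for i
    using recurrentD[OF assms(1), of "i + m"] assms(2)[of i] by (simp add: algebra_simps)
  then show ?thesis by (simp add: recurrent_def)
qed

text \<open>The determinant \<open>[q\<^sub>i, q\<^sub>j]\<close> of two lifts, the counterpart of \<open>pdiff\<close> for unnormalised
  coordinates.\<close>

definition bracket :: "(int \<Rightarrow> 'k::field) \<Rightarrow> (int \<Rightarrow> 'k) \<Rightarrow> int \<Rightarrow> int \<Rightarrow> 'k" where
  "bracket x y i j = x i * y j - x j * y i"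

lemma bracket_recurrent:
  assumes "recurrent c x" "recurrent c y"
  shows "bracket x y (i + 1) (i + 2) = c i * bracket x y i (i + 1)"
    "bracket x y i (i + 2) = bracket x y i (i + 1)"
  by (simp_all add: bracket_def recurrentD[OF assms(1)] recurrentD[OF assms(2)] algebra_simps)

lemma bracket_nonzero:
  assumes "\<And>i. c i \<noteq> 0" "recurrent c x" "recurrent c y" "bracket x y 0 1 \<noteq> 0"
  shows "bracket x y i (i + 1) \<noteq> 0"
proof (induction i rule: int_induct[where k = 0])
  case base
  show ?case using assms by simp
next
  case (step1 i)
  then show ?case using bracket_recurrent(1)[OF assms(2,3), of i] assms(1) by (simp add: add.assoc)
next
  case (step2 i)
  have e: "i - 1 + 2 = i + 1" "i - 1 + 1 = i" by simp_all
  have "bracket x y i (i + 1) = c (i - 1) * bracket x y (i - 1) (i - 1 + 1)"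
    using bracket_recurrent(1)[OF assms(2,3), of "i - 1"] by (simp only: e)
  with step2 show ?case by auto
qed

definition lifts :: "(int \<Rightarrow> 'k::field proj_line) \<Rightarrow> (int \<Rightarrow> 'k) \<Rightarrow> (int \<Rightarrow> 'k) \<Rightarrow> bool" where
  "lifts p x y \<longleftrightarrow> (\<forall>i. (x i, y i) \<noteq> (0, 0) \<and> p i = mk_point (x i) (y i))"

lemma liftsD:
  assumes "lifts p x y"
  shows "(x i, y i) \<noteq> (0, 0)" "p i = mk_point (x i) (y i)"
  using assms by (auto simp: lifts_def)

lemma bracket_lifts:
  assumes "lifts p x y"
  obtains s where "\<And>i. s i \<noteq> 0" "\<And>i j. bracket x y i j = s i * s j * pdiff (p i) (p j)"
proof -
  have "\<exists>s. s \<noteq> 0 \<and> x i = s * hx (p i) \<and> y i = s * hy (p i)" for i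
    using hx_hy_mk_point[OF liftsD(1)[OF assms, of i]] liftsD(2)[OF assms, of i] by metis
  then obtain s where s: "\<And>i. s i \<noteq> 0" "\<And>i. x i = s i * hx (p i)" "\<And>i. y i = s i * hy (p i)"
    by metis
  show ?thesis
    by (rule that[of s]) (use s in \<open>auto simp: bracket_def pdiff_def algebra_simps\<close>)
qed

lemma bracket_lifts_eq_0_iff:
  assumes "lifts p x y"
  shows "bracket x y i j = 0 \<longleftrightarrow> p i = p j"
  by (rule bracket_lifts[OF assms]) (auto simp: pdiff_eq_0_iff)

lemma cross_ratio_lifts:
  assumes "lifts (fst P) x y"
  shows "cross_ratio P i =
    (bracket x y i (i - 1) / bracket x y i (i + 2)) * (bracket x y (i + 1) (i + 2) / bracket x y (i + 1) (i - 1))"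
proof -
  obtain s where "\<And>i. s i \<noteq> 0" "\<And>i j. bracket x y i j = s i * s j * pdiff (fst P i) (fst P j)"
    using bracket_lifts[OF assms] by blast
  then show ?thesis by (simp add: cross_ratio_def Let_def)
qed

text \<open>The recurrence gives \<open>[q\<^sub>i, q\<^sub>i\<^sub>+\<^sub>2] = [q\<^sub>i, q\<^sub>i\<^sub>+\<^sub>1]\<close>. In the cross-ratio this cancels everything
  except \<open>[q\<^sub>i\<^sub>+\<^sub>1, q\<^sub>i\<^sub>+\<^sub>2] / [q\<^sub>i, q\<^sub>i\<^sub>+\<^sub>1]\<close>, which the recurrence evaluates to \<open>c\<^sub>i\<close>.\<close>

lemma cross_ratio_recurrent:
  assumes "lifts (fst P) x y" "recurrent c x" "recurrent c y" "\<And>i. bracket x y i (i + 1) \<noteq> 0"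
  shows "cross_ratio P i = c i"
proof -
  have e: "i - 1 + 2 = i + 1" "i - 1 + 1 = i" by simp_all
  have "bracket x y (i - 1) (i + 1) = bracket x y (i - 1) i"
    using bracket_recurrent(2)[OF assms(2,3), of "i - 1"] by (simp only: e)
  then have "bracket x y (i + 1) (i - 1) = bracket x y i (i - 1)"
    by (simp add: bracket_def algebra_simps)
  moreover have "bracket x y i (i - 1) \<noteq> 0"
    using assms(4)[of "i - 1"] by (auto simp: bracket_def algebra_simps)
  ultimately show ?thesis
    using assms(4)[of i]
    by (simp add: cross_ratio_lifts[OF assms(1)] bracket_recurrent[OF assms(2,3)])
qed

text \<open>Any three vectors in the plane are linearly dependent, so it suffices to rescale the lifts such that
  \<open>q\<^sub>i\<^sub>+\<^sub>2 - q\<^sub>i\<^sub>+\<^sub>1\<close> is parallel to \<open>q\<^sub>i\<close>. This is a first-order recurrence for the scaling factors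
  \<open>\<mu> i\<close>. The coefficient of \<open>q\<^sub>i\<close> that results is the cross-ratio by the previous lemma.\<close>

lemma recurrent_lift_exists:
  assumes "P \<in> ngons n"
  obtains x y where "recurrent (cross_ratio P) x" "recurrent (cross_ratio P) y" "lifts (fst P) x y"
    "\<And>i. bracket x y i (i + 1) \<noteq> 0"
proof -
  define p where "p = fst P"
  note ngon = ngonsD(2,3)[OF assms, folded p_def]
  define r where "r i = pdiff (p i) (p (i - 1)) / pdiff (p (i + 1)) (p (i - 1))" for i
  have pd: "pdiff (p i) (p (i + 1)) \<noteq> 0" "pdiff (p (i + 1)) (p i) \<noteq> 0"
    "pdiff (p i) (p (i + 2)) \<noteq> 0" "pdiff (p (i + 2)) (p i) \<noteq> 0" for i
    using ngon[of i] by (auto simp: pdiff_eq_0_iff)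
  have r: "r i \<noteq> 0" for i
    using ngon(1)[of "i - 1"] ngon(2)[of "i - 1"] by (auto simp: r_def pdiff_eq_0_iff add.commute)
  have "surj (\<lambda>u. u * r i)" for i
    by (rule surjI[of _ "\<lambda>u. u / r i"]) (simp add: r)
  then obtain \<mu> where \<mu>: "\<mu> 0 = 1" "\<And>i. \<mu> (i + 1) = \<mu> i * r i"
    using int_recurrence_exists[of "\<lambda>i u. u * r i" 1] by blast
  have nz: "\<mu> i \<noteq> 0" for i
  proof (induction i rule: int_induct[where k = 0])
    case (step2 i)
    then show ?case using \<mu>(2)[of "i - 1"] by auto
  qed (use \<mu> r in auto)
  define x where "x i = \<mu> i * hx (p i)" for i
  define y where "y i = \<mu> i * hy (p i)" for i
  have lifts: "lifts p x y"
    using nz hx_hy_nonzero by (auto simp: lifts_def x_def y_def mk_point_scale)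
  have br: "bracket x y i j = \<mu> i * \<mu> j * pdiff (p i) (p j)" for i j
    by (simp add: bracket_def x_def y_def pdiff_def algebra_simps)
  have adj: "bracket x y i (i + 1) \<noteq> 0" for i
    using pd nz by (simp add: br)
  \<comment> \<open>this is what the choice of \<open>r\<close> achieves\<close>
  have par: "bracket x y i (i + 2) = bracket x y i (i + 1)" for i
  proof -
    have "bracket x y (i + 2) i = bracket x y (i + 1) i"
      using \<mu>(2)[of "i + 1"] pd(4)[of i] by (simp add: br r_def add.assoc)
    then show ?thesis by (simp add: bracket_def algebra_simps)
  qed
  define c where "c i = bracket x y (i + 1) (i + 2) / bracket x y i (i + 1)" for i
  \<comment> \<open>the linear relation \<open>[u, v] w + [v, w] u + [w, u] v = 0\<close> for three consecutive lifts\<close>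
  have three: "z (i + 2) = z (i + 1) - c i * z i" if "z = x \<or> z = y" for z i
  proof -
    have "bracket x y i (i + 1) * z (i + 2) = bracket x y i (i + 2) * z (i + 1) - bracket x y (i + 1) (i + 2) * z i"
      using that by (auto simp: bracket_def algebra_simps)
    then have "bracket x y i (i + 1) * z (i + 2) = bracket x y i (i + 1) * (z (i + 1) - c i * z i)"
      using adj[of i] by (simp add: par c_def right_diff_distrib)
    with adj[of i] show ?thesis by simp
  qed
  then have rec: "recurrent c x" "recurrent c y" by (auto simp: recurrent_def)
  have "cross_ratio P = c"
    using cross_ratio_recurrent[OF lifts[unfolded p_def] rec adj] by blast
  with rec lifts adj that show ?thesis unfolding p_def by blast
qed

text \<open>The matrix that maps \<open>(x 0, y 0)\<close> to \<open>(x' 0, y' 0)\<close> and \<open>(x 1, y 1)\<close> to \<open>(x' 1, y' 1)\<close>.\<close>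

definition frame_map ::
  "(int \<Rightarrow> 'k::field) \<Rightarrow> (int \<Rightarrow> 'k) \<Rightarrow> (int \<Rightarrow> 'k) \<Rightarrow> (int \<Rightarrow> 'k) \<Rightarrow> 'k^2^2" where
  "frame_map x y x' y' = (let D = x 0 * y 1 - x 1 * y 0 in
     vector [vector [(x' 0 * y 1 - x' 1 * y 0) / D, (x' 1 * x 0 - x' 0 * x 1) / D],
             vector [(y' 0 * y 1 - y' 1 * y 0) / D, (y' 1 * x 0 - y' 0 * x 1) / D]])"

lemma frame_map:
  fixes c :: "int \<Rightarrow> 'k::field"
  assumes "\<And>i. c i \<noteq> 0" "recurrent c x" "recurrent c y" "recurrent c x'" "recurrent c y'"
    and "bracket x y 0 1 \<noteq> 0" "bracket x' y' 0 1 \<noteq> 0"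
  defines "A \<equiv> frame_map x y x' y'"
  shows "det A \<noteq> 0" "x' i = A $ 1 $ 1 * x i + A $ 1 $ 2 * y i" "y' i = A $ 2 $ 1 * x i + A $ 2 $ 2 * y i"
proof -
  define D where "D = x 0 * y 1 - x 1 * y 0"
  have D: "D \<noteq> 0" using assms(6) by (simp add: D_def bracket_def)
  have A: "A = vector [vector [(x' 0 * y 1 - x' 1 * y 0) / D, (x' 1 * x 0 - x' 0 * x 1) / D],
             vector [(y' 0 * y 1 - y' 1 * y 0) / D, (y' 1 * x 0 - y' 0 * x 1) / D]]"
    by (simp add: A_def frame_map_def D_def Let_def)
  have entries: "A $ 1 $ 1 = (x' 0 * y 1 - x' 1 * y 0) / D" "A $ 1 $ 2 = (x' 1 * x 0 - x' 0 * x 1) / D"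
    "A $ 2 $ 1 = (y' 0 * y 1 - y' 1 * y 0) / D" "A $ 2 $ 2 = (y' 1 * x 0 - y' 0 * x 1) / D"
    by (simp_all add: A)
  have interp: "(u * y 1 - v * y 0) / D * x 0 + (v * x 0 - u * x 1) / D * y 0 = u"
    "(u * y 1 - v * y 0) / D * x 1 + (v * x 0 - u * x 1) / D * y 1 = v" for u v
  proof -
    have "(u * y 1 - v * y 0) / D * x 0 + (v * x 0 - u * x 1) / D * y 0 = u * D / D"
      "(u * y 1 - v * y 0) / D * x 1 + (v * x 0 - u * x 1) / D * y 1 = v * D / D"
      by (simp_all add: D_def algebra_simps flip: add_divide_distrib diff_divide_distrib)
    with D show "(u * y 1 - v * y 0) / D * x 0 + (v * x 0 - u * x 1) / D * y 0 = u"
      "(u * y 1 - v * y 0) / D * x 1 + (v * x 0 - u * x 1) / D * y 1 = v" by simp_all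
  qed
  show 1: "x' i = A $ 1 $ 1 * x i + A $ 1 $ 2 * y i" for i
    by (rule recurrent_unique[OF assms(1,4) recurrent_linear[OF assms(2,3)]]) (simp_all only: entries interp)
  show 2: "y' i = A $ 2 $ 1 * x i + A $ 2 $ 2 * y i" for i
    by (rule recurrent_unique[OF assms(1,5) recurrent_linear[OF assms(2,3)]]) (simp_all only: entries interp)
  have "bracket x' y' 0 1 = det A * bracket x y 0 1"
    unfolding bracket_def 1 2 det_2 by (simp add: algebra_simps)
  with assms(7) show "det A \<noteq> 0" by auto
qed

text \<open>The recurrent lifts of both polygons satisfy the same recurrence, so the linear map between their
  initial frames maps all the lifts of one to those of the other.\<close>

lemma cross_ratio_eq_imp_cls_eq:
  assumes "P \<in> ngons n" "P' \<in> ngons n" "cross_ratio P = cross_ratio P'"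
  shows "cls P = cls P'"
proof -
  define c where "c = cross_ratio P"
  obtain x y where xy: "recurrent c x" "recurrent c y" "lifts (fst P) x y" "\<And>i. bracket x y i (i + 1) \<noteq> 0"
    using recurrent_lift_exists[OF assms(1)] unfolding c_def by blast
  obtain x' y' where xy': "recurrent c x'" "recurrent c y'" "lifts (fst P') x' y'"
    "\<And>i. bracket x' y' i (i + 1) \<noteq> 0"
    using recurrent_lift_exists[OF assms(2)] unfolding c_def assms(3) by blast
  define A where "A = frame_map x y x' y'"
  have A: "det A \<noteq> 0" "x' i = A $ 1 $ 1 * x i + A $ 1 $ 2 * y i" "y' i = A $ 2 $ 1 * x i + A $ 2 $ 2 * y i" for i
    using frame_map[of c x y x' y'] xy(1,2) xy'(1,2) xy(4)[of 0] xy'(4)[of 0]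
      cross_ratio_nonzero[OF assms(1)] unfolding A_def c_def by auto
  have p: "pgl_act (abs_pgl2 A) (fst P i) = fst P' i" for i
    unfolding liftsD(2)[OF xy(3)] liftsD(2)[OF xy'(3)] A(2,3)
    by (rule pgl_act_mk_point[OF A(1) liftsD(1)[OF xy(3)]])
  have Q: "act (abs_pgl2 A) P \<in> ngons n" by (rule act_in_ngons[OF assms(1)])
  have fQ: "fst (act (abs_pgl2 A) P) = fst P'" by (simp add: act_def p fun_eq_iff)
  have "act (abs_pgl2 A) P = P'" by (rule ngon_eqI[OF Q assms(2) fQ])
  then show ?thesis using cls_act by metis
qed

text \<open>Two independent solutions of the recurrence with coefficients \<open>c\<close> provide the vertices of a polygon with
  cross-ratios \<open>c\<close>. As \<open>c\<close> is periodic, the shift by a period acts linearly on solutions, and it is the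
  monodromy.\<close>

lemma recurrent_polygon:
  fixes c :: "int \<Rightarrow> 'k::field"
  assumes c: "\<And>i. c i \<noteq> 0" "\<And>i. c (i + int n) = c i"
    and rec: "recurrent c x" "recurrent c y" and D: "bracket x y 0 1 \<noteq> 0"
  defines "A \<equiv> frame_map x y (\<lambda>i. x (i + int n)) (\<lambda>i. y (i + int n))"
  defines "P \<equiv> (\<lambda>i. mk_point (x i) (y i), abs_pgl2 A)"
  shows "det A \<noteq> 0" "P \<in> ngons n" "cross_ratio P = c" "lifts (fst P) x y"
proof -
  note adj = bracket_nonzero[OF c(1) rec D]
  have D': "bracket (\<lambda>i. x (i + int n)) (\<lambda>i. y (i + int n)) 0 1 \<noteq> 0"
    using adj[of "int n"] by (simp add: bracket_def add.commute)
  note A = frame_map[OF c(1) rec recurrent_shift[OF rec(1) c(2)] recurrent_shift[OF rec(2) c(2)] D D', folded A_def]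
  show "det A \<noteq> 0" by (rule A)
  have nz: "(x i, y i) \<noteq> (0, 0)" for i
    using adj[of i] by (auto simp: bracket_def)
  show lifts: "lifts (fst P) x y" using nz by (auto simp: lifts_def P_def)
  show "cross_ratio P = c"
    using cross_ratio_recurrent[OF lifts rec adj] by blast
  have "fst P (i + int n) = pgl_act (snd P) (fst P i)" for i
    unfolding P_def fst_conv snd_conv pgl_act_mk_point[OF A(1) nz] A(2) A(3) by (rule refl)
  moreover have ne1: "fst P i \<noteq> fst P (i + 1)" for i
    using adj[of i] bracket_lifts_eq_0_iff[OF lifts, of i "i + 1"] by blast
  moreover have "fst P i \<noteq> fst P (i + 2)" for i
    using adj[of i] bracket_lifts_eq_0_iff[OF lifts, of i "i + 2"] bracket_recurrent(2)[OF rec, of i] by metis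
  moreover have "fst P (i + 1) \<noteq> fst P (i + 2)" for i
    using ne1[of "i + 1"] by (simp add: add.assoc)
  ultimately show "P \<in> ngons n" by (simp add: ngons_def split_beta)
qed

lemma exists_ngon_with_cross_ratio:
  fixes c :: "int \<Rightarrow> 'k::field"
  assumes "\<And>i. c i \<noteq> 0" "\<And>i. c (i + int n) = c i"
  obtains P where "P \<in> ngons n" "cross_ratio P = c"
proof -
  obtain x where x: "x 0 = 1" "x 1 = 0" "recurrent c x"
    using recurrent_exists[of c 1 0] assms(1) by blast
  obtain y where y: "y 0 = 0" "y 1 = 1" "recurrent c y"
    using recurrent_exists[of c 0 1] assms(1) by blast
  have "bracket x y 0 1 \<noteq> 0" using x y by (simp add: bracket_def)
  from recurrent_polygon(2,3)[OF assms x(3) y(3) this] that show ?thesis by blast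
qed

text \<open>That the vertices are periodic only means that each lift is multiplied by some factor after a
  period. The recurrence has periodic coefficients and relates three consecutive lifts, and
  two of them are independent; this forces the factors of all the lifts to be equal.\<close>

lemma closed_iff_lift_quasiperiodic:
  assumes "P \<in> ngons n" "recurrent (cross_ratio P) x" "recurrent (cross_ratio P) y" "lifts (fst P) x y"
  shows "closed_polygon P \<longleftrightarrow> (\<exists>\<nu>. \<nu> \<noteq> 0 \<and> (\<forall>i. x (i + int n) = \<nu> * x i \<and> y (i + int n) = \<nu> * y i))"
proof
  assume closed: "closed_polygon P"
  define c where "c = cross_ratio P"
  note rec = assms(2,3)[folded c_def]
  have c: "c i \<noteq> 0" "c (i + int n) = c i" for i
    using cross_ratio_nonzero[OF assms(1)] cross_ratio_periodic[OF assms(1)] by (auto simp: c_def)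
  have adj: "bracket x y i (i + 1) \<noteq> 0" for i
    using ngonsD(2)[OF assms(1)] bracket_lifts_eq_0_iff[OF assms(4)] by auto
  have "\<exists>s. s \<noteq> 0 \<and> x (i + int n) = s * x i \<and> y (i + int n) = s * y i" for i
  proof -
    have "mk_point (x i) (y i) = mk_point (x (i + int n)) (y (i + int n))"
      using ngonsD(1)[OF assms(1), of i] closed
      unfolding closed_polygon_def by (simp add: liftsD(2)[OF assms(4)])
    then have "x i * y (i + int n) = y i * x (i + int n)"
      using mk_point_eq_iff[OF liftsD(1)[OF assms(4)] liftsD(1)[OF assms(4)]] by (simp add: algebra_simps)
    from parallel_imp_scaled[OF liftsD(1)[OF assms(4)] liftsD(1)[OF assms(4)] this] show ?thesis by metis
  qed
  then obtain s where s: "\<And>i. s i \<noteq> 0" "\<And>i. x (i + int n) = s i * x i" "\<And>i. y (i + int n) = s i * y i"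
    by metis
  \<comment> \<open>the difference of \<open>s 2\<close> times the recurrence at \<open>0\<close> and the recurrence at \<open>n\<close>\<close>
  have "(s 2 - s 1) * z 1 = c 0 * (s 2 - s 0) * z 0"
    if "z = x \<or> z = y" for z
  proof -
    have z: "z (i + int n) = s i * z i" "z (i + 2) = z (i + 1) - c i * z i" for i
      using that s recurrentD[OF rec(1)] recurrentD[OF rec(2)] by auto
    have "z (2 + int n) = z (1 + int n) - c 0 * z (0 + int n)"
      using z(2)[of "int n"] c(2)[of 0] by (simp add: add.commute)
    then have "s 2 * z 2 = s 1 * z 1 - c 0 * (s 0 * z 0)" unfolding z(1) .
    moreover have "z 2 = z 1 - c 0 * z 0" using z(2)[of 0] by simp
    ultimately have "s 2 * (z 1 - c 0 * z 0) = s 1 * z 1 - c 0 * (s 0 * z 0)" by simp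
    then show ?thesis by (simp add: algebra_simps)
  qed
  then have e: "(s 2 - s 1) * x 1 = c 0 * (s 2 - s 0) * x 0" "(s 2 - s 1) * y 1 = c 0 * (s 2 - s 0) * y 0"
    by blast+
  have "(s 2 - s 1) * bracket x y 0 1 = x 0 * ((s 2 - s 1) * y 1) - (s 2 - s 1) * x 1 * y 0"
    by (simp add: bracket_def algebra_simps)
  also have "\<dots> = 0" unfolding e by simp
  finally have "s 2 = s 1" using adj[of 0] by simp
  with e liftsD(1)[OF assms(4), of 0] c(1)[of 0] have s01: "s 1 = s 0" by auto
  have "x (i + int n) = s 0 * x i" for i
    using recurrent_unique[OF c(1) recurrent_shift[OF rec(1) c(2)] recurrent_linear[OF rec(1,1), of "s 0" 0], of i]
      s(2)[of 0] s(2)[of 1] s01 by simp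
  moreover have "y (i + int n) = s 0 * y i" for i
    using recurrent_unique[OF c(1) recurrent_shift[OF rec(2) c(2)] recurrent_linear[OF rec(2,2), of "s 0" 0], of i]
      s(3)[of 0] s(3)[of 1] s01 by simp
  ultimately show "\<exists>\<nu>. \<nu> \<noteq> 0 \<and> (\<forall>i. x (i + int n) = \<nu> * x i \<and> y (i + int n) = \<nu> * y i)"
    using s(1) by blast
next
  assume "\<exists>\<nu>. \<nu> \<noteq> 0 \<and> (\<forall>i. x (i + int n) = \<nu> * x i \<and> y (i + int n) = \<nu> * y i)"
  then obtain \<nu> where \<nu>: "\<nu> \<noteq> 0" "\<And>i. x (i + int n) = \<nu> * x i" "\<And>i. y (i + int n) = \<nu> * y i" by blast
  have fixed: "pgl_act (snd P) (fst P i) = fst P i" for i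
    using ngonsD(1)[OF assms(1), of i] \<nu> by (simp add: liftsD(2)[OF assms(4)] mk_point_scale)
  have "snd P = pgl_one"
  proof (rule pgl_eqI_three_points[of "fst P 0" "fst P 1" "fst P 2"])
    show "distinct [fst P 0, fst P 1, fst P 2]"
      using ngonsD(2,3)[OF assms(1), of 0] ngonsD(2)[OF assms(1), of 1] by simp
  qed (simp add: fixed)
  then show "closed_polygon P" by (simp add: closed_polygon_def)
qed

section \<open>The trace of a perturbed monodromy\<close>

text \<open>The index \<open>(j + k - 1) mod k\<close> is the cyclic predecessor of \<open>j\<close>. Splitting off \<open>j = 0\<close>, where it
  wraps around, leaves pairs of consecutive indices.\<close>

lemma prod_cyclic_predecessor:
  "(\<Prod>j<Suc m. h j ((j + Suc m - 1) mod Suc m)) = h 0 m * (\<Prod>j<m. h (Suc j) j)"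
proof -
  have "(\<Prod>j<m. h (Suc j) ((Suc j + Suc m - 1) mod Suc m)) = (\<Prod>j<m. h (Suc j) j)"
  proof (rule prod.cong[OF refl])
    fix j assume "j \<in> {..<m}"
    then have "(Suc j + Suc m - 1) mod Suc m = j" 
      using mod_add_self2[of j "Suc m"] by simp
    then show "h (Suc j) ((Suc j + Suc m - 1) mod Suc m) = h (Suc j) j" by simp
  qed
  then show ?thesis unfolding prod.lessThan_Suc_shift by simp
qed

text \<open>Index sets \<open>i\<^sub>1 < \<dots> < i\<^sub>k\<close> of all sizes \<open>k\<close>. As lists they record the order in which the
  noncommuting factors of a product are multiplied.\<close>

definition increasing_lists :: "nat \<Rightarrow> int list set" where
  "increasing_lists m = {ks. sorted_wrt (<) ks \<and> set ks \<subseteq> {1..int m}}"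

lemma increasing_lists_0: "increasing_lists 0 = {[]}"
  by (auto simp: increasing_lists_def)

lemma increasing_lists_Suc:
  "increasing_lists (Suc m) = increasing_lists m \<union> (\<lambda>ks. ks @ [int (Suc m)]) ` increasing_lists m"
proof (intro equalityI subsetI)
  fix ks assume "ks \<in> increasing_lists (Suc m)"
  then have ks: "sorted_wrt (<) ks" "set ks \<subseteq> {1..int (Suc m)}" by (auto simp: increasing_lists_def)
  show "ks \<in> increasing_lists m \<union> (\<lambda>ks. ks @ [int (Suc m)]) ` increasing_lists m"
  proof (cases "int (Suc m) \<in> set ks")
    case False
    have "set ks \<subseteq> {1..int m}"
    proof
      fix i assume "i \<in> set ks"
      with ks False have "1 \<le> i" "i \<le> int (Suc m)" "i \<noteq> int (Suc m)" by auto
      then show "i \<in> {1..int m}" by simp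
    qed
    with ks show ?thesis by (simp add: increasing_lists_def)
  next
    case True
    then obtain us vs where uv: "ks = us @ int (Suc m) # vs" by (meson split_list)
    have "vs = []"
    proof (rule ccontr)
      assume "vs \<noteq> []"
      then have "hd vs \<in> set vs" by simp
      with uv ks show False by (auto simp: sorted_wrt_append) (meson hd_in_set in_mono not_le subsetD atLeastAtMost_iff)
    qed
    moreover have "set us \<subseteq> {1..int m}"
      using ks uv by (fastforce simp: sorted_wrt_append)
    ultimately show ?thesis using ks uv by (auto simp: increasing_lists_def sorted_wrt_append)
  qed
next
  fix ks assume "ks \<in> increasing_lists m \<union> (\<lambda>ks. ks @ [int (Suc m)]) ` increasing_lists m"
  then show "ks \<in> increasing_lists (Suc m)"
    by (fastforce simp: increasing_lists_def sorted_wrt_append)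
qed

lemma increasing_lists_disjoint:
  "increasing_lists m \<inter> (\<lambda>ks. ks @ [int (Suc m)]) ` increasing_lists m = {}"
  by (auto simp: increasing_lists_def)

lemma finite_increasing_lists: "finite (increasing_lists m)"
  by (induction m) (simp_all add: increasing_lists_0 increasing_lists_Suc)

lemma increasing_list_gap:
  assumes "sorted_wrt (<) (ks :: int list)" "\<And>j. Suc j < length ks \<Longrightarrow> ks ! Suc j \<noteq> ks ! j + 1"
  shows "j < length ks \<Longrightarrow> ks ! 0 + 2 * int j \<le> ks ! j"
proof (induction j)
  case (Suc j)
  then have "ks ! j < ks ! Suc j" using assms(1) by (simp add: sorted_wrt_iff_nth_less)
  with Suc assms(2)[of j] show ?case by force
qed simp

text \<open>Among more than half of the vertices of a cycle, two are neighbours: otherwise the entries grow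
  by at least two at each step, which leaves room only if the list runs from \<open>1\<close> to \<open>n\<close>, and then its
  ends are neighbours in the cycle.\<close>

lemma cyclic_neighbours_exist:
  assumes "ks \<in> increasing_lists n" "length ks = Suc m" "Suc m > n div 2"
  shows "(\<exists>j<m. ks ! Suc j = ks ! j + 1) \<or> (ks ! 0 = 1 \<and> ks ! m = int n)"
proof (rule ccontr)
  assume *: "\<not> ?thesis"
  have ks: "sorted_wrt (<) ks" "set ks \<subseteq> {1..int n}" using assms(1) by (auto simp: increasing_lists_def)
  have "ks ! 0 \<in> set ks" "ks ! m \<in> set ks" using assms(2) by auto
  with ks have b: "1 \<le> ks ! 0" "ks ! m \<le> int n" by auto
  have "ks ! 0 + 2 * int m \<le> ks ! m"
    using increasing_list_gap[OF ks(1), of m] * assms(2) by auto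
  moreover have "n \<le> 2 * m + 1" using assms(3) by linarith
  ultimately have "ks ! 0 = 1" "ks ! m = int n" using b by linarith+
  with * show False by blast
qed

text \<open>The formula for \<open>G\<^sub>k\<close> with the logarithmic derivatives \<open>c\<^sub>i'(1) / c\<^sub>i(1)\<close> replaced by arbitrary
  weights \<open>e i\<close>. It makes sense for any sequence of points, without a symmetry. The value at \<open>k = 0\<close> is
  the trace of the identity.\<close>

definition trace_coeff :: "(int \<Rightarrow> 'k::field proj_line) \<Rightarrow> (int \<Rightarrow> 'k) \<Rightarrow> nat \<Rightarrow> nat \<Rightarrow> 'k" where
  "trace_coeff p e n k = (if k = 0 then 2 else
     (\<Sum>ks\<in>{ks :: int list. length ks = k \<and> sorted_wrt (<) ks \<and> set ks \<subseteq> {1..int n}}.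
        (\<Prod>j<k. e (ks ! j)) *
        ((\<Prod>j<k. pdiff (p (ks ! j)) (p (ks ! ((j + k - 1) mod k) + 1))) /
         (\<Prod>j<k. pdiff (p (ks ! j)) (p (ks ! j + 1))))))"

text \<open>The map \<open>v \<mapsto> [v, q\<^sub>j\<^sub>+\<^sub>1] q\<^sub>i\<close>. Its index \<open>j\<close> is shifted such that \<open>i = j\<close> gives the projection below.\<close>

definition rank_one :: "(int \<Rightarrow> 'k::field) \<Rightarrow> (int \<Rightarrow> 'k) \<Rightarrow> int \<Rightarrow> int \<Rightarrow> 'k^2^2" where
  "rank_one x y i j = vector [vector [x i * y (j + 1), - (x i * x (j + 1))],
                              vector [y i * y (j + 1), - (y i * x (j + 1))]]"

text \<open>The projection onto \<open>q\<^sub>i\<close> along \<open>q\<^sub>i\<^sub>+\<^sub>1\<close>; it does not depend on the scaling of the lifts.\<close>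

definition projection :: "(int \<Rightarrow> 'k::field) \<Rightarrow> (int \<Rightarrow> 'k) \<Rightarrow> int \<Rightarrow> 'k^2^2" where
  "projection x y i = mat (1 / bracket x y i (i + 1)) ** rank_one x y i i"

text \<open>The sign of the first column is the one for which \<open>L(c\<^sub>i)\<close> maps each frame to the next one.\<close>

definition frame :: "(int \<Rightarrow> 'k::field) \<Rightarrow> (int \<Rightarrow> 'k) \<Rightarrow> int \<Rightarrow> 'k^2^2" where
  "frame x y i = vector [vector [- x i, x (i + 1)], vector [- y i, y (i + 1)]]"

lemma mat2_eq_iff: "A = B \<longleftrightarrow> A $ 1 $ 1 = B $ 1 $ 1 \<and> A $ 1 $ 2 = B $ 1 $ 2 \<and> A $ 2 $ 1 = B $ 2 $ 1 \<and> A $ 2 $ 2 = B $ 2 $ 2"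
  for A B :: "'k^2^2"
  by (auto simp: vec_eq_iff forall_2)

lemma trace2: "trace A = A $ 1 $ 1 + A $ 2 $ 2" for A :: "'k::field^2^2"
  by (simp add: trace_def sum_2)

lemma trace_mat_mult: "trace (mat s ** A) = s * trace A" for A :: "'k::field^2^2"
  by (simp add: trace2 mat_mult_entry algebra_simps)

lemma rank_one_mult: "rank_one x y a b ** rank_one x y i j = mat (bracket x y i (b + 1)) ** rank_one x y a j"
  unfolding mat2_eq_iff mat_mult_entry mat2_mult_nth[of "rank_one x y a b"]
  by (simp add: rank_one_def bracket_def algebra_simps)

lemma trace_rank_one: "trace (rank_one x y i j) = bracket x y i (j + 1)"
  by (simp add: trace2 rank_one_def bracket_def algebra_simps)

text \<open>The key computation. For \<open>\<delta> = 0\<close> it says that \<open>L(c\<^sub>i)\<close> passes from one frame to the next. A change of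
  \<open>c\<^sub>i\<close> by \<open>\<delta>\<close> perturbs only the second column, by a multiple of \<open>q\<^sub>i\<close>, and seen from
  the left of the frame this is a rank-one perturbation of the identity.\<close>

lemma frame_L_matrix:
  assumes "recurrent c x" "recurrent c y" "c i \<noteq> 0" "bracket x y i (i + 1) \<noteq> 0"
  shows "frame x y i ** L_matrix (c i + \<delta>) =
    (mat 1 + mat (\<delta> / c i) ** projection x y i) ** frame x y (i + 1)"
proof -
  have *: "\<delta> / c i * (1 / bracket x y i (i + 1) * (z i * bracket x y (i + 1) (i + 2))) = \<delta> * z i" for z :: "int \<Rightarrow> 'a"
    using assms(3,4) by (simp add: bracket_recurrent[OF assms(1,2)])
  have z: "z (i + 2) - \<delta> * z i = - (z i * (c i + \<delta>)) + z (i + 1)" if "z = x \<or> z = y" for z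
    using that recurrentD[OF assms(1), of i] recurrentD[OF assms(2), of i] by (auto simp: algebra_simps)
  define e where "e = \<delta> / c i * (1 / bracket x y i (i + 1))"
  have e: "e * (z i * bracket x y (i + 1) (i + 2)) = \<delta> * z i" for z
    unfolding e_def using *[of z] by (simp only: mult.assoc)
  have P: "mat (\<delta> / c i) ** projection x y i = mat e ** rank_one x y i i"
    by (simp add: projection_def mat_mult_mat_left e_def)
  have "(mat 1 + mat (\<delta> / c i) ** projection x y i) ** frame x y (i + 1) =
      vector [vector [- x (i + 1), x (i + 2) - e * (x i * bracket x y (i + 1) (i + 2))],
              vector [- y (i + 1), y (i + 2) - e * (y i * bracket x y (i + 1) (i + 2))]]"
    unfolding P mat2_eq_iff mat2_mult_nth[of _ "frame x y (i + 1)"] vector_add_component mat_mult_entry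
    by (simp add: mat_def rank_one_def frame_def bracket_def add.assoc algebra_simps)
  also have "\<dots> = frame x y i ** L_matrix (c i + \<delta>)"
    unfolding e using z[of x] z[of y] by (simp add: mat2_eq_iff mat2_mult_nth frame_def L_matrix_def)
  finally show ?thesis by simp
qed

definition projection_word :: "(int \<Rightarrow> 'k::field) \<Rightarrow> (int \<Rightarrow> 'k) \<Rightarrow> int list \<Rightarrow> 'k^2^2" where
  "projection_word x y ks = foldl (\<lambda>A i. A ** projection x y i) (mat 1) ks"

lemma mat2_sum_mult: "sum f S ** B = (\<Sum>i\<in>S. f i ** B)"
  for f :: "'i \<Rightarrow> 'k::field^2^2" and B :: "'k^2^2"
  by (simp add: mat2_eq_iff mat2_mult_nth sum.distrib sum_distrib_right)

text \<open>Moving the frame through the product turns each \<open>L\<close> into a factor \<open>1 + (\<delta> i / c i) \<cdot>\<close> projection.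
  Expanding these factors gives one word for each choice of indices: an increasing
  list bounded by \<open>m + 1\<close> either omits \<open>m + 1\<close> or ends with it.\<close>

lemma frame_L_product:
  fixes c :: "int \<Rightarrow> 'k::field"
  assumes "recurrent c x" "recurrent c y" "\<And>i. c i \<noteq> 0" "\<And>i. bracket x y i (i + 1) \<noteq> 0"
  shows "frame x y 1 ** L_product m (\<lambda>i. c i + \<delta> i) =
    (\<Sum>ks\<in>increasing_lists m. mat (prod_list (map (\<lambda>i. \<delta> i / c i) ks)) ** projection_word x y ks) **
      frame x y (int m + 1)"
proof (induction m)
  case 0
  show ?case by (simp add: increasing_lists_0 projection_word_def)
next
  case (Suc m)
  define w where "w ks = mat (prod_list (map (\<lambda>i. \<delta> i / c i) ks)) ** projection_word x y ks" for ks
  let ?i = "int (Suc m)"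
  have w: "w (ks @ [?i]) = w ks ** (mat (\<delta> ?i / c ?i) ** projection x y ?i)" for ks
    by (simp add: w_def projection_word_def mat_left_commute[of "foldl _ _ _"] mat_mult_mat_left mult.commute flip: matrix_mul_assoc)
  have "inj_on (\<lambda>ks. ks @ [?i]) (increasing_lists m)" by (auto simp: inj_on_def)
  then have "sum w (increasing_lists (Suc m)) =
      sum w (increasing_lists m) + (\<Sum>ks\<in>increasing_lists m. w ks ** (mat (\<delta> ?i / c ?i) ** projection x y ?i))"
    unfolding increasing_lists_Suc
    by (subst sum.union_disjoint)
      (simp_all only: finite_increasing_lists finite_imageI increasing_lists_disjoint sum.reindex o_def w)
  also have "\<dots> = sum w (increasing_lists m) ** (mat 1 + mat (\<delta> ?i / c ?i) ** projection x y ?i)"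
    by (simp add: matrix_add_ldistrib mat2_sum_mult)
  finally have S: "sum w (increasing_lists (Suc m)) =
    sum w (increasing_lists m) ** (mat 1 + mat (\<delta> ?i / c ?i) ** projection x y ?i)" .
  have "frame x y 1 ** L_product (Suc m) (\<lambda>i. c i + \<delta> i) =
      sum w (increasing_lists m) ** (frame x y ?i ** L_matrix (c ?i + \<delta> ?i))"
    using Suc by (simp add: w_def matrix_mul_assoc add.commute)
  also have "\<dots> = sum w (increasing_lists (Suc m)) ** frame x y (?i + 1)"
    unfolding S frame_L_matrix[OF assms(1,2) assms(3) assms(4)] by (simp only: matrix_mul_assoc)
  finally show ?case by (simp add: w_def)
qed

text \<open>All factors have rank one, so each adjacent pair of factors contributes a scalar
  \<open>[q\<^bsub>i'\<^esub>, q\<^bsub>i+1\<^esub>]\<close> and only the outer vectors remain.\<close>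

lemma projection_word_closed_form:
  assumes "length ks = Suc m"
  shows "projection_word x y ks =
    mat ((\<Prod>j<m. bracket x y (ks ! Suc j) (ks ! j + 1)) / (\<Prod>j<Suc m. bracket x y (ks ! j) (ks ! j + 1))) **
    rank_one x y (ks ! 0) (ks ! m)"
  using assms
proof (induction m arbitrary: ks)
  case 0
  then obtain i where "ks = [i]" by (auto simp: length_Suc_conv)
  then show ?case by (simp add: projection_word_def projection_def)
next
  case (Suc m)
  then obtain us i where us: "ks = us @ [i]" "length us = Suc m"
    by (metis length_Suc_conv_rev)
  have nth: "ks ! Suc m = i" "j < Suc m \<Longrightarrow> ks ! j = us ! j" for j
    using us by (simp_all add: nth_append)
  have 1: "(\<Prod>j<Suc m. bracket x y (ks ! Suc j) (ks ! j + 1)) =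
     (\<Prod>j<m. bracket x y (us ! Suc j) (us ! j + 1)) * bracket x y i (us ! m + 1)"
    by (simp add: nth)
  have 2: "(\<Prod>j<Suc (Suc m). bracket x y (ks ! j) (ks ! j + 1)) =
     (\<Prod>j<Suc m. bracket x y (us ! j) (us ! j + 1)) * bracket x y i (i + 1)"
    by (simp add: nth)
  have "projection_word x y ks = projection_word x y us ** projection x y i"
    by (simp add: projection_word_def us)
  then show ?case
    unfolding 1 2 Suc.IH[OF us(2)] nth
    by (simp add: projection_def mat_left_commute[of "rank_one _ _ _ _"] rank_one_mult mat_mult_mat_left mult_ac nth
      flip: matrix_mul_assoc)
qed

text \<open>The trace closes the chain of scalars cyclically. Every vertex then occurs equally often in the
  numerator and in the denominator, so the scaling factors of the lifts cancel.\<close>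

lemma trace_projection_word:
  fixes p :: "int \<Rightarrow> 'k::field proj_line"
  assumes "lifts p x y" "length ks = Suc m"
  shows "trace (projection_word x y ks) =
    (\<Prod>j<Suc m. pdiff (p (ks ! j)) (p (ks ! ((j + Suc m - 1) mod Suc m) + 1))) /
    (\<Prod>j<Suc m. pdiff (p (ks ! j)) (p (ks ! j + 1)))"
proof -
  obtain s where s: "\<And>i. s i \<noteq> 0" "\<And>i j. bracket x y i j = s i * s j * pdiff (p i) (p j)"
    using bracket_lifts[OF assms(1)] by blast
  define S where "S = (\<Prod>j<Suc m. s (ks ! j)) * (\<Prod>j<Suc m. s (ks ! j + 1))"
  have "S \<noteq> 0" using s by (simp add: S_def)
  have "trace (projection_word x y ks) =
     (bracket x y (ks ! 0) (ks ! m + 1) * (\<Prod>j<m. bracket x y (ks ! Suc j) (ks ! j + 1))) /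
     (\<Prod>j<Suc m. bracket x y (ks ! j) (ks ! j + 1))"
    by (simp add: projection_word_closed_form[OF assms(2)] trace_mat_mult trace_rank_one mult.commute)
  also have "bracket x y (ks ! 0) (ks ! m + 1) * (\<Prod>j<m. bracket x y (ks ! Suc j) (ks ! j + 1)) =
     (\<Prod>j<Suc m. bracket x y (ks ! j) (ks ! ((j + Suc m - 1) mod Suc m) + 1))"
    by (rule prod_cyclic_predecessor[symmetric])
  also have "\<dots> = (\<Prod>j<Suc m. s (ks ! j)) * (\<Prod>j<Suc m. s (ks ! ((j + Suc m - 1) mod Suc m) + 1)) *
      (\<Prod>j<Suc m. pdiff (p (ks ! j)) (p (ks ! ((j + Suc m - 1) mod Suc m) + 1)))"
    by (simp only: s(2) prod.distrib)
  also have "(\<Prod>j<Suc m. s (ks ! ((j + Suc m - 1) mod Suc m) + 1)) = (\<Prod>j<Suc m. s (ks ! j + 1))"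
    unfolding prod_cyclic_predecessor[of "\<lambda>j j'. s (ks ! j' + 1)"] by simp
  also have "(\<Prod>j<Suc m. bracket x y (ks ! j) (ks ! j + 1)) = S * (\<Prod>j<Suc m. pdiff (p (ks ! j)) (p (ks ! j + 1)))"
    by (simp only: s(2) prod.distrib S_def)
  finally show ?thesis
    using \<open>S \<noteq> 0\<close> by (simp only: S_def[symmetric]) simp
qed

lemma trace_sum: "trace (sum f S) = (\<Sum>i\<in>S. trace (f i))" for f :: "'i \<Rightarrow> 'k::field^2^2"
  by (simp add: trace2 sum.distrib)

lemma trace_coeff_eq_sum:
  assumes "lifts p x y"
  shows "trace_coeff p e n k =
    (\<Sum>ks\<in>{ks\<in>increasing_lists n. length ks = k}. prod_list (map e ks) * trace (projection_word x y ks))"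
proof (cases k)
  case 0
  have "{ks\<in>increasing_lists n. length ks = 0} = {[]}" by (auto simp: increasing_lists_def)
  then show ?thesis using 0 by (simp add: trace_coeff_def projection_word_def trace2 mat_def)
next
  case (Suc m)
  have "(\<Prod>j<k. e (ks ! j)) = prod_list (map e ks)" if "length ks = k" for ks
    using that by (simp add: prod.list_conv_set_nth atLeast0LessThan)
  then show ?thesis unfolding trace_coeff_def
    by (simp add: Suc increasing_lists_def trace_projection_word[OF assms] conj_ac del: prod.lessThan_Suc cong: conj_cong)
qed

text \<open>Two cyclic neighbours among the indices produce a factor \<open>pdiff p\<^sub>i p\<^sub>i = 0\<close>, and more than
  \<open>n / 2\<close> indices contain neighbours. The neighbours may be \<open>n\<close> and \<open>1\<close>; this case uses periodicity.\<close>

lemma trace_coeff_eq_0: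
  assumes "\<And>i. p (i + int n) = p i" "k > n div 2"
  shows "trace_coeff p e n k = 0"
proof -
  obtain m where k: "k = Suc m" using assms(2) by (cases k) auto
  have "(\<Prod>j<Suc m. pdiff (p (ks ! j)) (p (ks ! ((j + Suc m - 1) mod Suc m) + 1))) = 0"
    if ks: "length ks = Suc m" "sorted_wrt (<) ks" "set ks \<subseteq> {1..int n}" for ks
  proof -
    have "ks \<in> increasing_lists n" using ks by (simp add: increasing_lists_def)
    from cyclic_neighbours_exist[OF this ks(1) assms(2)[unfolded k]] show ?thesis
    proof
      assume "\<exists>j<m. ks ! Suc j = ks ! j + 1"
      then obtain j where "j < m" "pdiff (p (ks ! Suc j)) (p (ks ! j + 1)) = 0" by auto
      then show ?thesis
        unfolding prod_cyclic_predecessor[of "\<lambda>j j'. pdiff (p (ks ! j)) (p (ks ! j' + 1))"] by auto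
    next
      assume "ks ! 0 = 1 \<and> ks ! m = int n"
      then have "pdiff (p (ks ! 0)) (p (ks ! m + 1)) = 0"
        using assms(1)[of 1] by (simp add: add.commute)
      then show ?thesis
        unfolding prod_cyclic_predecessor[of "\<lambda>j j'. pdiff (p (ks ! j)) (p (ks ! j' + 1))"] by simp
    qed
  qed
  then show ?thesis
    unfolding trace_coeff_def k by (intro if_not_P[THEN trans] sum.neutral ballI) simp_all
qed

lemma trace_similar:
  fixes A S :: "'k::field^2^2"
  assumes "invertible S"
  shows "trace (S ** A ** matrix_inv S) = trace A"
proof -
  have "trace (S ** A ** matrix_inv S) = trace (matrix_inv S ** (S ** A))" by (rule trace_mul_sym)
  then show ?thesis by (simp add: matrix_mul_assoc matrix_inv_cancel[OF assms])
qed

text \<open>For a closed polygon the last frame is a multiple of the first one, so the product of the \<open>L\<close> is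
  conjugate to the sum over projection words, up to that multiple \<open>\<nu>\<close>. Sorting the traces of the words by
  length gives the coefficients.\<close>

lemma L_product_closed:
  fixes P :: "'k::field polygon"
  assumes "P \<in> ngons n" "closed_polygon P"
  obtains \<nu> where "\<nu> \<noteq> 0" "L_product n (cross_ratio P) = mat \<nu>"
    "\<forall>d s. trace (L_product n (\<lambda>i. cross_ratio P i + d i * s)) =
       \<nu> * (\<Sum>k\<le>n div 2. trace_coeff (fst P) (\<lambda>i. d i / cross_ratio P i) n k * s ^ k)"
proof -
  define c where "c = cross_ratio P"
  have c: "c i \<noteq> 0" for i using cross_ratio_nonzero[OF assms(1)] by (simp add: c_def)
  obtain x y where xy: "recurrent c x" "recurrent c y" "lifts (fst P) x y" "\<And>i. bracket x y i (i + 1) \<noteq> 0"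
    using recurrent_lift_exists[OF assms(1)] unfolding c_def by blast
  obtain \<nu> where \<nu>: "\<nu> \<noteq> 0" "\<And>i. x (i + int n) = \<nu> * x i" "\<And>i. y (i + int n) = \<nu> * y i"
    using closed_iff_lift_quasiperiodic[OF assms(1) xy(1,2)[unfolded c_def] xy(3)] assms(2) by blast
  have frame: "frame x y (int n + 1) = mat \<nu> ** frame x y 1"
    using \<nu>(2,3)[of 1] \<nu>(2,3)[of 2]
    by (simp add: mat2_eq_iff mat_mult_entry frame_def add.commute add.left_commute)
  have "det (frame x y 1) = - bracket x y 1 2"
    by (simp add: det_2 frame_def bracket_def)
  with xy(4)[of 1] have inv: "invertible (frame x y 1)" by (simp add: invertible_det_nz)
  let ?F = "frame x y 1"
  define \<Phi> where "\<Phi> e = (\<Sum>ks\<in>increasing_lists n. mat (prod_list (map e ks)) ** projection_word x y ks)" for e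
  have L: "L_product n (\<lambda>i. c i + \<delta> i) = mat \<nu> ** (matrix_inv ?F ** \<Phi> (\<lambda>i. \<delta> i / c i) ** ?F)" for \<delta>
  proof -
    have "?F ** L_product n (\<lambda>i. c i + \<delta> i) = \<Phi> (\<lambda>i. \<delta> i / c i) ** (mat \<nu> ** ?F)"
      unfolding frame_L_product[OF xy(1,2) c xy(4)] frame \<Phi>_def ..
    then have "matrix_inv ?F ** ?F ** L_product n (\<lambda>i. c i + \<delta> i) =
        matrix_inv ?F ** (\<Phi> (\<lambda>i. \<delta> i / c i) ** (mat \<nu> ** ?F))"
      by (simp flip: matrix_mul_assoc)
    then show ?thesis
      by (simp add: matrix_inv_cancel[OF inv] mat_left_commute[of "\<Phi> _"] mat_left_commute[of "matrix_inv _"]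
        flip: matrix_mul_assoc)
  qed
  have fin: "finite (increasing_lists n)" by (rule finite_increasing_lists)
  have "\<Phi> (\<lambda>i. 0) = mat 1"
  proof -
    have "\<Phi> (\<lambda>i. 0) = (\<Sum>ks\<in>increasing_lists n. if ks = [] then mat 1 else 0)"
      unfolding \<Phi>_def
    proof (rule sum.cong[OF refl])
      fix ks :: "int list"
      show "mat (prod_list (map (\<lambda>i. 0) ks)) ** projection_word x y ks = (if ks = [] then mat 1 else 0)"
        by (cases ks) (auto simp: projection_word_def mat2_eq_iff mat_mult_entry)
    qed
    moreover have "[] \<in> increasing_lists n" by (simp add: increasing_lists_def)
    ultimately show ?thesis using fin by (simp add: sum.delta)
  qed
  with L[of "\<lambda>i. 0"] have "L_product n c = mat \<nu>"
    by (simp add: matrix_inv_cancel[OF inv])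
  moreover have "trace (L_product n (\<lambda>i. c i + d i * s)) =
       \<nu> * (\<Sum>k\<le>n div 2. trace_coeff (fst P) (\<lambda>i. d i / c i) n k * s ^ k)" for d s
  proof -
    let ?e = "\<lambda>i. d i / c i"
    let ?t = "\<lambda>ks. prod_list (map ?e ks) * trace (projection_word x y ks)"
    have len: "length ks \<le> n" if "ks \<in> increasing_lists n" for ks
    proof -
      have "distinct ks" using that by (auto simp: increasing_lists_def strict_sorted_iff)
      then have "length ks = card (set ks)" by (simp add: distinct_card)
      also have "\<dots> \<le> card {1..int n}" using that by (intro card_mono) (auto simp: increasing_lists_def)
      finally show ?thesis by simp
    qed
    have scale: "prod_list (map (\<lambda>i. d i * s / c i) ks) = prod_list (map ?e ks) * s ^ length ks" for ks
      by (induction ks) (simp_all add: mult_ac)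
    have "trace (L_product n (\<lambda>i. c i + d i * s)) = \<nu> * trace (matrix_inv ?F ** \<Phi> (\<lambda>i. d i * s / c i) ** ?F)"
      by (simp add: L trace_mat_mult)
    also have "trace (matrix_inv ?F ** \<Phi> (\<lambda>i. d i * s / c i) ** ?F) = trace (\<Phi> (\<lambda>i. d i * s / c i))"
      by (subst trace_mul_sym) (simp add: matrix_mul_assoc matrix_inv_cancel[OF inv])
    also have "\<dots> = (\<Sum>ks\<in>increasing_lists n. ?t ks * s ^ length ks)"
      unfolding \<Phi>_def trace_sum trace_mat_mult scale by (simp add: mult_ac)
    also have "\<dots> = (\<Sum>k\<le>n. \<Sum>ks\<in>{ks\<in>increasing_lists n. length ks = k}. ?t ks * s ^ length ks)"
      using len by (intro sum.group[symmetric] fin) auto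
    also have "\<dots> = (\<Sum>k\<le>n. trace_coeff (fst P) ?e n k * s ^ k)"
      by (simp add: trace_coeff_eq_sum[OF xy(3)] sum_distrib_right)
    also have "\<dots> = (\<Sum>k\<le>n div 2. trace_coeff (fst P) ?e n k * s ^ k)"
    proof (rule sum.mono_neutral_right)
      have "fst P (i + int n) = fst P i" for i
        using ngonsD(1)[OF assms(1)] assms(2) by (simp add: closed_polygon_def)
      then show "\<forall>k\<in>{..n} - {..n div 2}. trace_coeff (fst P) ?e n k * s ^ k = 0"
        by (auto simp: trace_coeff_eq_0)
    qed auto
    finally show ?thesis .
  qed
  ultimately show ?thesis using \<nu>(1) that unfolding c_def by blast
qed

section \<open>Polynomial functions of a parameter\<close>

text \<open>A polynomial function that is nonzero somewhere is nonzero for almost all values of the parameter, in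
  the sense of the filter \<open>cofinite\<close>. Over an infinite field this takes the place of continuity and of
  open dense sets.\<close>

definition polyfun :: "('k::field \<Rightarrow> 'k) \<Rightarrow> bool" where
  "polyfun g \<longleftrightarrow> (\<exists>p. \<forall>t. g t = poly p t)"

lemma polyfun_const: "polyfun (\<lambda>t. a)"
  unfolding polyfun_def by (intro exI[of _ "[:a:]"]) simp

lemma polyfun_add: "polyfun g \<Longrightarrow> polyfun h \<Longrightarrow> polyfun (\<lambda>t. g t + h t)"
  unfolding polyfun_def by (metis poly_add)

lemma polyfun_diff: "polyfun g \<Longrightarrow> polyfun h \<Longrightarrow> polyfun (\<lambda>t. g t - h t)"
  unfolding polyfun_def by (metis poly_diff)

lemma polyfun_mult: "polyfun g \<Longrightarrow> polyfun h \<Longrightarrow> polyfun (\<lambda>t. g t * h t)"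
  unfolding polyfun_def by (metis poly_mult)

lemma polyfun_ident: "polyfun (\<lambda>t. t)"
  unfolding polyfun_def by (intro exI[of _ "[:0, 1:]"]) simp

lemma polyfun_divide: "polyfun g \<Longrightarrow> polyfun (\<lambda>t. g t / a)"
  using polyfun_mult[OF _ polyfun_const[of "inverse a"]] by (simp add: divide_inverse)

lemma polyfun_power: "polyfun g \<Longrightarrow> polyfun (\<lambda>t. g t ^ m)"
  unfolding polyfun_def by (metis poly_power)

lemma polyfun_sum: "(\<And>i. i \<in> S \<Longrightarrow> polyfun (g i)) \<Longrightarrow> polyfun (\<lambda>t. \<Sum>i\<in>S. g i t)"
  by (induction S rule: infinite_finite_induct) (auto intro: polyfun_add polyfun_const)

lemma polyfun_prod: "(\<And>i. i \<in> S \<Longrightarrow> polyfun (g i)) \<Longrightarrow> polyfun (\<lambda>t. \<Prod>i\<in>S. g i t)"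
  by (induction S rule: infinite_finite_induct) (auto intro: polyfun_mult polyfun_const)

lemma polyfun_if: "polyfun g \<Longrightarrow> polyfun h \<Longrightarrow> polyfun (\<lambda>t. if b then g t else h t)"
  by (cases b) simp_all

lemmas polyfun_intros = polyfun_if polyfun_const polyfun_ident polyfun_add polyfun_diff polyfun_mult
  polyfun_divide polyfun_power polyfun_sum polyfun_prod

lemma polyfun_mpoly_eval:
  assumes "\<And>j. polyfun (\<lambda>t. \<xi> t j)"
  shows "polyfun (\<lambda>t. mpoly_eval f (\<xi> t))"
  unfolding mpoly_eval_def by (intro polyfun_intros assms)

lemma polyfun_nonzero_cofinite:
  assumes "polyfun g" "g a \<noteq> 0"
  shows "\<forall>\<^sub>F t in cofinite. g t \<noteq> 0"
proof -
  obtain p where p: "\<And>t. g t = poly p t" using assms(1) by (auto simp: polyfun_def)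
  with assms(2) have "p \<noteq> 0" by auto
  then show ?thesis by (simp add: eventually_cofinite p poly_roots_finite)
qed

lemma poly_nonzero_cofinite:
  "poly p (a::'k::field) \<noteq> 0 \<Longrightarrow> \<forall>\<^sub>F t in cofinite. poly p t \<noteq> 0"
  by (rule polyfun_nonzero_cofinite[of "poly p" a]) (auto simp: polyfun_def)

lemma poly_eqI_cofinite:
  assumes "infinite (UNIV :: 'k::field set)" "\<forall>\<^sub>F t in cofinite. poly p t = poly q (t :: 'k)"
  shows "p = q"
proof (rule ccontr)
  assume "p \<noteq> q"
  then have "finite {t. poly (p - q) t = 0}" by (intro poly_roots_finite) simp
  moreover have "finite {t. poly p t \<noteq> poly q t}" using assms(2) by (simp add: eventually_cofinite)
  moreover have "UNIV = {t. poly (p - q) t = 0} \<union> {t. poly p t \<noteq> poly q t}" by auto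
  ultimately show False using assms(1) by (metis finite_UnI)
qed

text \<open>This is how equality of the coefficients \<open>G\<^sub>k\<close> is obtained from equality of traces.\<close>

lemma shifted_coefficients_unique:
  fixes a b :: "nat \<Rightarrow> 'k::field"
  assumes "infinite (UNIV :: 'k set)"
    and "\<forall>\<^sub>F t in cofinite. (\<Sum>k\<le>m. a k * (t - 1) ^ k) = (\<Sum>k\<le>m. b k * (t - 1) ^ k)"
    and "k \<le> m"
  shows "a k = b k"
proof -
  define p where "p f = (\<Sum>k\<le>m. monom (f k) k)" for f :: "nat \<Rightarrow> 'k"
  have poly_p: "poly (p f) s = (\<Sum>k\<le>m. f k * s ^ k)" for f s
    by (simp add: p_def poly_sum poly_monom)
  have "poly (pcompose (p f) [:- 1, 1:]) t = (\<Sum>k\<le>m. f k * (t - 1) ^ k)" for f t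
    by (simp add: poly_pcompose poly_p)
  with assms have "pcompose (p a) [:- 1, 1:] = pcompose (p b) [:- 1, 1:]"
    by (intro poly_eqI_cofinite) auto
  then have "pcompose (p a) (pcompose [:- 1, 1:] [:1, 1:]) = pcompose (p b) (pcompose [:- 1, 1:] [:1, 1:])"
    by (simp only: pcompose_assoc)
  then have "p a = p b" by (simp add: pcompose_pCons)
  moreover have "coeff (p f) k = f k" for f
    using assms(3) by (simp add: p_def coeff_sum)
  ultimately show ?thesis by metis
qed

section \<open>Cross-ratios along an orbit of the symmetry\<close>

lemma periodic_shift:
  assumes "\<And>i. f (i + m) = f (i :: int)"
  shows "f (i + k * m) = f i"
proof (induction k rule: int_induct[where k = 0])
  case (step1 k)
  then show ?case using assms[of "i + k * m"] by (simp add: algebra_simps)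
next
  case (step2 k)
  then show ?case using assms[of "i + (k - 1) * m"] by (simp add: algebra_simps)
qed simp

lemma moduliE:
  assumes "x \<in> moduli n"
  obtains P where "P \<in> ngons n" "x = cls P" "\<And>i. class_cr x i = cross_ratio P i"
  using assms by (auto simp: moduli_def)

lemma rational_map_local_form:
  assumes "rational_map F X Y \<phi>" "\<phi> x = Some y"
  obtains f \<xi> where "X x \<xi>" "Y y (\<lambda>j. mpoly_eval (f j) \<xi>)"
    "\<forall>x' \<xi> y'. X x' \<xi> \<and> Y y' (\<lambda>j. mpoly_eval (f j) \<xi>) \<longrightarrow> \<phi> x' = Some y'"
proof -
  from assms(1) have "\<forall>x y. \<phi> x = Some y \<longrightarrow>
        (\<exists>f :: nat \<Rightarrow> 'a mpoly.
           (\<forall>j m. Poly_Mapping.lookup (f j) m \<in> F) \<and>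
           (\<exists>\<xi>. X x \<xi> \<and> Y y (\<lambda>j. mpoly_eval (f j) \<xi>)) \<and>
           (\<forall>x' \<xi> y'. X x' \<xi> \<and> Y y' (\<lambda>j. mpoly_eval (f j) \<xi>) \<longrightarrow> \<phi> x' = Some y'))"
    unfolding rational_map_def by (rule conjunct2)
  from this[rule_format, OF assms(2)] show ?thesis
  proof (elim exE conjE)
    fix f :: "nat \<Rightarrow> 'a mpoly" and \<xi>
    assume f: "X x \<xi>" "Y y (\<lambda>j. mpoly_eval (f j) \<xi>)"
      "\<forall>x' \<xi> y'. X x' \<xi> \<and> Y y' (\<lambda>j. mpoly_eval (f j) \<xi>) \<longrightarrow> \<phi> x' = Some y'"
    then show thesis by (rule that)
  qed
qed

lemma symmetry_in_moduli:
  assumes "rational_map F (Gm_moduli_coords n) (moduli_coords n) (\<lambda>(t, x). \<rho> t x)" "\<rho> t x = Some y"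
  shows "t \<noteq> 0" "x \<in> moduli n" "y \<in> moduli n"
proof -
  have "(\<lambda>(t, x). \<rho> t x) (t, x) = Some y" using assms(2) by simp
  then obtain f \<xi>
    where "Gm_moduli_coords n (t, x) \<xi>" "moduli_coords n y (\<lambda>j. mpoly_eval (f j) \<xi>)"
    by (rule rational_map_local_form[OF assms(1)])
  then show "t \<noteq> 0" "x \<in> moduli n" "y \<in> moduli n"
    by (auto simp: Gm_moduli_coords_def moduli_coords_def)
qed

text \<open>Near \<open>(a, x)\<close> the symmetry is given by polynomials in the coordinates of \<open>(t, x)\<close>. Only the
  coordinate with index \<open>n + 1\<close> involves \<open>t\<close>, so they become polynomials in \<open>t\<close> whose quotients are the
  cross-ratios of \<open>\<rho> t x\<close>. Every nonzero periodic sequence consists of the cross-ratios of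
  some polygon. Therefore the polynomials describe a point of the moduli space as soon as finitely many of
  them do not vanish, which holds for almost all \<open>t\<close>.\<close>

lemma symmetry_rational_in_parameter:
  fixes \<rho> :: "'k::field \<Rightarrow> 'k polygon set \<Rightarrow> 'k polygon set option"
  assumes rat: "rational_map F (Gm_moduli_coords n) (moduli_coords n) (\<lambda>(t, x). \<rho> t x)"
    and "n > 0" "\<rho> a x = Some y"
  obtains N D where "poly D a \<noteq> 0" "\<And>i. class_cr y i = poly (N i) a / poly D a"
    "\<forall>\<^sub>F t in cofinite. \<exists>z. \<rho> t x = Some z \<and> (\<forall>i::int. class_cr z i = poly (N i) t / poly D t)"
proof -
  have "(\<lambda>(t, x). \<rho> t x) (a, x) = Some y" using assms(3) by simp
  then obtain f \<xi> where f: "Gm_moduli_coords n (a, x) \<xi>" "moduli_coords n y (\<lambda>j. mpoly_eval (f j) \<xi>)"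
      "\<forall>x' \<xi> z. Gm_moduli_coords n x' \<xi> \<and> moduli_coords n z (\<lambda>j. mpoly_eval (f j) \<xi>) \<longrightarrow>
        (\<lambda>(t, x). \<rho> t x) x' = Some z"
    by (rule rational_map_local_form[OF rat])
  define \<zeta> where "\<zeta> t = \<xi>(n + 1 := t * \<xi> 0)" for t
  have \<zeta>a: "\<zeta> a = \<xi>" using f(1) by (auto simp: \<zeta>_def Gm_moduli_coords_def)
  have "polyfun (\<lambda>t. \<zeta> t j)" for j
    by (cases "j = n + 1") (auto simp: \<zeta>_def intro!: polyfun_intros)
  then have "polyfun (\<lambda>t. mpoly_eval (f j) (\<zeta> t))" for j by (rule polyfun_mpoly_eval)
  then obtain h where h: "\<And>j t. mpoly_eval (f j) (\<zeta> t) = poly (h j) t" unfolding polyfun_def by metis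
  \<comment> \<open>the index in \<open>{1..n}\<close> congruent to \<open>i\<close>; the coordinates cover one period only\<close>
  define r where "r i = nat ((i - 1) mod int n + 1)" for i :: int
  have r: "r i \<in> {1..n}" for i
  proof -
    have "0 \<le> (i - 1) mod int n" "(i - 1) mod int n < int n" using \<open>n > 0\<close> by simp_all
    then show ?thesis by (auto simp: r_def)
  qed
  have cr_r: "class_cr z i = class_cr z (int (r i))" if z: "z \<in> moduli n" for z i
  proof -
    obtain P where P: "P \<in> ngons n" "\<And>i. class_cr z i = cross_ratio P i" using moduliE[OF z] by blast
    have "int (r i) = i + (- ((i - 1) div int n)) * int n"
      using \<open>n > 0\<close> minus_div_mult_eq_mod[of "i - 1" "int n"] by (simp add: r_def algebra_simps)
    then show ?thesis
      using periodic_shift[of "cross_ratio P" "int n", OF cross_ratio_periodic[OF P(1)]] by (simp only: P(2))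
  qed
  have y: "y \<in> moduli n" "poly (h 0) a \<noteq> 0" "i \<in> {1..n} \<Longrightarrow> poly (h i) a = class_cr y (int i) * poly (h 0) a" for i
    using f(2) unfolding moduli_coords_def \<zeta>a[symmetric] h by auto
  have ya: "poly (h i) a \<noteq> 0" if "i \<in> {1..n}" for i
  proof -
    obtain Q where "Q \<in> ngons n" "\<And>i. class_cr y i = cross_ratio Q i" using moduliE[OF y(1)] by blast
    with y(2,3) that show ?thesis using cross_ratio_nonzero[of Q n] by auto
  qed
  have "\<forall>\<^sub>F t in cofinite. t \<noteq> 0" by (simp add: eventually_cofinite)
  moreover have "\<forall>\<^sub>F t in cofinite. \<forall>j\<in>{1..n}. poly (h j) t \<noteq> 0"
    using ya by (intro eventually_ball_finite ballI poly_nonzero_cofinite) auto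
  ultimately have "\<forall>\<^sub>F t in cofinite. \<exists>z. \<rho> t x = Some z \<and>
      (\<forall>i. class_cr z i = poly (h (r i)) t / poly (h 0) t)"
    using poly_nonzero_cofinite[OF y(2)]
  proof eventually_elim
    case (elim t)
    define c where "c i = poly (h (r i)) t / poly (h 0) t" for i
    have "c i \<noteq> 0" for i using elim r by (simp add: c_def)
    moreover have "c (i + int n) = c i" for i
    proof -
      have "(i + int n - 1) mod int n = (i - 1 + int n) mod int n" by (simp add: algebra_simps)
      then show ?thesis by (simp add: c_def r_def)
    qed
    ultimately obtain P where P: "P \<in> ngons n" "cross_ratio P = c" by (rule exists_ngon_with_cross_ratio)
    have "r (int i) = i" if "i \<in> {1..n}" for i
      using that by (auto simp: r_def)
    then have "moduli_coords n (cls P) (\<lambda>j. mpoly_eval (f j) (\<zeta> t))"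
      using P elim by (auto simp: moduli_coords_def moduli_def h c_def)
    moreover have "Gm_moduli_coords n (t, x) (\<zeta> t)"
      using f(1) elim by (auto simp: Gm_moduli_coords_def moduli_coords_def \<zeta>_def)
    ultimately have "\<rho> t x = Some (cls P)"
      using f(3)[THEN spec, THEN spec, THEN spec, of "(t, x)" "\<zeta> t" "cls P"] by simp
    with P show ?case by (simp add: c_def)
  qed
  moreover have "class_cr y i = poly (h (r i)) a / poly (h 0) a" for i
    using y(2) y(3)[OF r] cr_r[OF y(1)] by (metis nonzero_mult_div_cancel_right)
  ultimately show ?thesis using that[of "h 0" "\<lambda>i. h (r i)"] y(2) by blast
qed

text \<open>The local form of the symmetry at a parameter gives a local formula for \<open>c\<^sub>i(t)\<close>. Formulas found at two
  parameters agree for almost all \<open>t\<close>, hence as rational functions, so each of them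
  represents \<open>c\<^sub>i\<close> globally, and the value obtained by continuation is the actual
  cross-ratio wherever the symmetry is defined.\<close>

lemma cr_t_eq_class_cr:
  fixes \<rho> :: "'k::field \<Rightarrow> 'k polygon set \<Rightarrow> 'k polygon set option"
  assumes inf: "infinite (UNIV :: 'k set)"
    and rat: "rational_map F (Gm_moduli_coords n) (moduli_coords n) (\<lambda>(t, x). \<rho> t x)"
    and "n > 0" and a: "\<rho> a (cls P) = Some y"
  shows "cr_t \<rho> P i a = class_cr y i"
proof -
  let ?f = "\<lambda>t. map_option (\<lambda>x. class_cr x i) (\<rho> t (cls P))"
  obtain N D where ND: "poly D a \<noteq> 0" "\<And>i. class_cr y i = poly (N i) a / poly D a"
    "\<forall>\<^sub>F t in cofinite. \<exists>z. \<rho> t (cls P) = Some z \<and> (\<forall>i::int. class_cr z i = poly (N i) t / poly D t)"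
    using symmetry_rational_in_parameter[OF rat \<open>n > 0\<close> a] by blast
  have "rat_repr ?f (N i) D"
    unfolding rat_repr_def
  proof (intro allI impI)
    fix b v assume b: "?f b = Some v \<and> poly D b \<noteq> 0"
    then obtain z where z: "\<rho> b (cls P) = Some z" "v = class_cr z i" by auto
    obtain N' D' where ND': "poly D' b \<noteq> 0" "\<And>i. class_cr z i = poly (N' i) b / poly D' b"
      "\<forall>\<^sub>F t in cofinite. \<exists>z. \<rho> t (cls P) = Some z \<and> (\<forall>i::int. class_cr z i = poly (N' i) t / poly D' t)"
      using symmetry_rational_in_parameter[OF rat \<open>n > 0\<close> z(1)] by blast
    have "\<forall>\<^sub>F t in cofinite. poly (N i * D') t = poly (N' i * D) t"
      using ND(3) ND'(3) poly_nonzero_cofinite[OF ND(1)] poly_nonzero_cofinite[OF ND'(1)]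
    proof eventually_elim
      case (elim t)
      then have "poly (N i) t / poly D t = poly (N' i) t / poly D' t" by (metis option.inject)
      with elim(3,4) show ?case by (simp add: frac_eq_eq)
    qed
    then have "N i * D' = N' i * D" by (rule poly_eqI_cofinite[OF inf])
    then have "poly (N i) b * poly D' b = poly (N' i) b * poly D b" by (metis poly_mult)
    with b z ND' show "v = poly (N i) b / poly D b" by (simp add: frac_eq_eq)
  qed
  moreover have "?f a = Some (class_cr y i)" using a by simp
  ultimately show ?thesis
    unfolding cr_t_def rat_value_def using ND(1) ND(2)[of i]
  proof (intro the_equality)
    fix v assume "\<exists>N D. rat_repr ?f N D \<and> poly D a \<noteq> 0 \<and> v = poly N a / poly D a"
    with \<open>?f a = Some (class_cr y i)\<close> show "v = class_cr y i"
      unfolding rat_repr_def by metis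
  qed blast
qed

section \<open>Transformations along one-parameter families\<close>

text \<open>A polygon is determined by \<open>n\<close> vertices and a monodromy. By equivariance, distinctness of nearby vertices
  has to be checked over one period only. With \<open>n \<ge> 2\<close> all the vertices concerned have
  indices below \<open>2 n\<close>, so a single application of the monodromy reaches them.\<close>

lemma ngon_of_vectors:
  fixes B :: "'k::field^2^2" and u v :: "nat \<Rightarrow> 'k"
  assumes n: "n \<ge> 2" and B: "det B \<noteq> 0"
    and shift: "\<And>i. i < n \<Longrightarrow> u (i + n) = B $ 1 $ 1 * u i + B $ 1 $ 2 * v i"
      "\<And>i. i < n \<Longrightarrow> v (i + n) = B $ 2 $ 1 * u i + B $ 2 $ 2 * v i"
    and ne: "\<And>i. i < n \<Longrightarrow> u i * v (i + 1) - u (i + 1) * v i \<noteq> 0"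
      "\<And>i. i < n \<Longrightarrow> u i * v (i + 2) - u (i + 2) * v i \<noteq> 0"
  obtains Q where "Q \<in> ngons n" "snd Q = abs_pgl2 B" "\<forall>i<n. fst Q (int i) = mk_point (u i) (v i)"
proof -
  define M where "M = abs_pgl2 B"
  have "surj (\<lambda>w (j::int). pgl_act M (w j))"
    by (rule surjI[of _ "\<lambda>w j. pgl_act (pgl_inverse M) (w j)"]) (simp add: pgl_act_inverse)
  from int_recurrence_exists[of "\<lambda>_ w j. pgl_act M (w j)", OF this, of "\<lambda>j. mk_point (u (nat j)) (v (nat j))"]
  obtain W :: "int \<Rightarrow> int \<Rightarrow> 'k proj_line" where
    W: "W 0 = (\<lambda>j. mk_point (u (nat j)) (v (nat j)))" "\<And>i. W (i + 1) = (\<lambda>j. pgl_act M (W i j))"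
    by blast
  define q where "q i = W (i div int n) (i mod int n)" for i
  have q_shift: "q (i + int n) = pgl_act M (q i)" for i
    using n by (simp add: q_def W(2))
  have nz1: "(u i, v i) \<noteq> (0, 0)" if "i < n" for i
    using ne(1)[OF that] by auto
  have q_small: "q (int i) = mk_point (u i) (v i)" if "i < n" for i
    using that by (simp add: q_def W(1))
  have q_nz: "q (int i) = mk_point (u i) (v i) \<and> (u i, v i) \<noteq> (0, 0)" if "i < 2 * n" for i
  proof (cases "i < n")
    case True
    then show ?thesis using q_small nz1 by blast
  next
    case False
    define j where "j = i - n"
    have j: "i = j + n" "j < n" using False that by (simp_all add: j_def)
    have "q (int i) = pgl_act M (mk_point (u j) (v j))" using q_shift[of "int j"] q_small[OF j(2)] j by simp
    then show ?thesis
      unfolding M_def pgl_act_mk_point[OF B nz1[OF j(2)]] j(1) shift[OF j(2)]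
      using mat2_image_nonzero[OF B nz1[OF j(2)]] by blast
  qed
  define ok where "ok i \<longleftrightarrow> q i \<noteq> q (i + 1) \<and> q i \<noteq> q (i + 2)" for i
  have ok_small: "ok (int i)" if "i < n" for i
  proof -
    have "i < 2 * n" "i + 1 < 2 * n" "i + 2 < 2 * n" using that n by simp_all
    note q = this[THEN q_nz]
    have "q (int i) \<noteq> q (int (i + 1))" "q (int i) \<noteq> q (int (i + 2))"
      using q mk_point_eq_iff[of "u i" "v i" "u (i + 1)" "v (i + 1)"] ne(1)[OF that]
        mk_point_eq_iff[of "u i" "v i" "u (i + 2)" "v (i + 2)"] ne(2)[OF that] by metis+
    then show ?thesis by (simp add: ok_def add.commute)
  qed
  have ok: "ok i" for i
  proof -
    have "ok (j + int n) = ok j" for j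
      using q_shift[of j] q_shift[of "j + 1"] q_shift[of "j + 2"] by (simp add: ok_def algebra_simps)
    from periodic_shift[of ok, OF this, of "i mod int n" "i div int n"]
    have "ok i = ok (i mod int n)" by simp
    moreover have "i mod int n = int (nat (i mod int n))" "nat (i mod int n) < n"
      using n by (simp_all add: nat_less_iff)
    ultimately show ?thesis using ok_small by metis
  qed
  have "q (i + 1) \<noteq> q (i + 2)" for i
    using ok[of "i + 1"] by (simp add: ok_def add.assoc)
  with ok have "(q, M) \<in> ngons n" by (simp add: ngons_def q_shift ok_def)
  with q_small that show ?thesis by (simp add: M_def)
qed

text \<open>Being the coordinates of a polygon is an open condition: it amounts to the nonvanishing of
  finitely many polynomials in the coordinates.\<close>

lemma ngon_coords_open:
  fixes \<eta> :: "'k::field \<Rightarrow> nat \<Rightarrow> 'k"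
  assumes n: "n \<ge> 2" and poly: "\<And>j. polyfun (\<lambda>t. \<eta> t j)" and a: "ngon_coords n Q (\<eta> a)"
  shows "\<forall>\<^sub>F t in cofinite. \<exists>Q'. ngon_coords n Q' (\<eta> t)"
proof -
  define B where "B t = (vector [vector [\<eta> t (2 * n), \<eta> t (2 * n + 1)],
    vector [\<eta> t (2 * n + 2), \<eta> t (2 * n + 3)]] :: 'k^2^2)" for t
  define u where "u t i = (if i < n then \<eta> t (2 * i)
    else \<eta> t (2 * n) * \<eta> t (2 * (i - n)) + \<eta> t (2 * n + 1) * \<eta> t (2 * (i - n) + 1))" for t i
  define v where "v t i = (if i < n then \<eta> t (2 * i + 1)
    else \<eta> t (2 * n + 2) * \<eta> t (2 * (i - n)) + \<eta> t (2 * n + 3) * \<eta> t (2 * (i - n) + 1))" for t i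
  have uv: "u t i = \<eta> t (2 * i)" "v t i = \<eta> t (2 * i + 1)" if "i < n" for t i
    using that by (simp_all add: u_def v_def)
  have shift: "u t (i + n) = B t $ 1 $ 1 * u t i + B t $ 1 $ 2 * v t i"
    "v t (i + n) = B t $ 2 $ 1 * u t i + B t $ 2 $ 2 * v t i" if "i < n" for t i
    using that by (simp_all add: u_def v_def B_def)
  have polyuv: "polyfun (\<lambda>t. u t i)" "polyfun (\<lambda>t. v t i)" "polyfun (\<lambda>t. det (B t))" for i
    unfolding u_def v_def B_def det_2 vector_2 by (intro polyfun_intros poly)+
  have Q: "Q \<in> ngons n" "det (B a) \<noteq> 0" "snd Q = abs_pgl2 (B a)"
    "\<And>i. i < n \<Longrightarrow> (u a i, v a i) \<noteq> (0, 0) \<and> fst Q (int i) = mk_point (u a i) (v a i)"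
    using a by (auto simp: ngon_coords_def B_def Let_def uv)
  have Q2: "(u a i, v a i) \<noteq> (0, 0) \<and> fst Q (int i) = mk_point (u a i) (v a i)" if "i < 2 * n" for i
  proof (cases "i < n")
    case True
    then show ?thesis using Q(4) by blast
  next
    case False
    define j where "j = i - n"
    have j: "i = j + n" "j < n" using False that by (simp_all add: j_def)
    have "fst Q (int i) = pgl_act (abs_pgl2 (B a)) (mk_point (u a j) (v a j))"
      using ngonsD(1)[OF Q(1), of "int j"] Q(3) Q(4)[OF j(2)] j by simp
    then show ?thesis
      using Q(4)[OF j(2)] pgl_act_mk_point[OF Q(2), of "u a j" "v a j"] mat2_image_nonzero[OF Q(2), of "u a j" "v a j"]
      unfolding j(1) shift[OF j(2)] by simp
  qed
  have ne: "u a i * v a (i + 1) - u a (i + 1) * v a i \<noteq> 0" "u a i * v a (i + 2) - u a (i + 2) * v a i \<noteq> 0"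
    if "i < n" for i
  proof -
    have "i < 2 * n" "i + 1 < 2 * n" "i + 2 < 2 * n" using that n by simp_all
    note q = this[THEN Q2]
    have "fst Q (int i) \<noteq> fst Q (int (i + 1))" "fst Q (int i) \<noteq> fst Q (int (i + 2))"
      using ngonsD(2,3)[OF Q(1), of "int i"] by (simp_all add: add.commute)
    then show "u a i * v a (i + 1) - u a (i + 1) * v a i \<noteq> 0" "u a i * v a (i + 2) - u a (i + 2) * v a i \<noteq> 0"
      using q mk_point_eq_iff[of "u a i" "v a i" "u a (i + 1)" "v a (i + 1)"]
        mk_point_eq_iff[of "u a i" "v a i" "u a (i + 2)" "v a (i + 2)"] by metis+
  qed
  have "\<forall>\<^sub>F t in cofinite. \<forall>i\<in>{..<n}. u t i * v t (i + 1) - u t (i + 1) * v t i \<noteq> 0"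
    by (intro eventually_ball_finite ballI polyfun_nonzero_cofinite[where a = a] polyfun_intros polyuv ne) auto
  moreover have "\<forall>\<^sub>F t in cofinite. \<forall>i\<in>{..<n}. u t i * v t (i + 2) - u t (i + 2) * v t i \<noteq> 0"
    by (intro eventually_ball_finite ballI polyfun_nonzero_cofinite[where a = a] polyfun_intros polyuv ne) auto
  moreover have "\<forall>\<^sub>F t in cofinite. det (B t) \<noteq> 0"
    by (rule polyfun_nonzero_cofinite[OF polyuv(3) Q(2)])
  ultimately show ?thesis
  proof eventually_elim
    case (elim t)
    have "u t i * v t (i + 1) - u t (i + 1) * v t i \<noteq> 0" "u t i * v t (i + 2) - u t (i + 2) * v t i \<noteq> 0"
      if "i < n" for i
      using elim(1,2) that by blast+
    from ngon_of_vectors[of n "B t" "u t" "v t", OF n elim(3) shift this]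
    obtain Q' where Q': "Q' \<in> ngons n" "snd Q' = abs_pgl2 (B t)"
      "\<forall>i<n. fst Q' (int i) = mk_point (u t i) (v t i)"
      by blast
    have "(u t i, v t i) \<noteq> (0, 0)" if "i < n" for i
      using elim(1) that by force
    with Q' elim(3) have "ngon_coords n Q' (\<eta> t)"
      unfolding ngon_coords_def Let_def B_def[symmetric] by (simp add: uv)
    then show ?case ..
  qed
qed

text \<open>The solution of the recurrence at natural indices. It is defined for all coefficients, and it depends
  polynomially on them, whereas negative indices would require division.\<close>

fun rec_seq :: "(int \<Rightarrow> 'k::field) \<Rightarrow> 'k \<Rightarrow> 'k \<Rightarrow> nat \<Rightarrow> 'k" where
  "rec_seq c a b 0 = a"
| "rec_seq c a b (Suc 0) = b"
| "rec_seq c a b (Suc (Suc m)) = rec_seq c a b (Suc m) - c (int m) * rec_seq c a b m"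

lemma recurrent_eq_rec_seq:
  assumes "recurrent c x"
  shows "x (int m) = rec_seq c (x 0) (x 1) m"
proof (induction m rule: induct_nat_012)
  case (ge2 m)
  then show ?case using recurrentD[OF assms, of "int m"] by (simp add: add.commute)
qed simp_all

lemma polyfun_rec_seq:
  assumes "\<And>i. polyfun (\<lambda>t. c t i)"
  shows "polyfun (\<lambda>t. rec_seq (c t) a b m)"
  by (induction m rule: induct_nat_012) (auto intro!: polyfun_intros assms)

lemma closed_ngon_size:
  assumes "P \<in> ngons n" "closed_polygon P" "n > 0"
  shows "n \<ge> 2"
proof (rule ccontr)
  assume "\<not> n \<ge> 2"
  with assms(3) have "n = 1" by simp
  with ngonsD(1,2)[OF assms(1), of 0] assms(2) show False by (simp add: closed_polygon_def)
qed

text \<open>With a fixed initial frame and varying cross-ratios \<open>c t\<close>, the recurrence produces a polygon whose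
  coordinates are polynomials in \<open>t\<close> and which is \<open>P\<close> for \<open>t = a\<close>. The local form of \<open>T\<close> at \<open>P\<close> turns
  them into coordinates that are again polynomials in \<open>t\<close>. At \<open>t = a\<close> they describe the polygon
  \<open>Q\<close>, hence they describe some polygon for almost all \<open>t\<close>, and there \<open>T\<close> is defined.\<close>

lemma transformation_defined_along_family:
  fixes P :: "'k::field polygon" and c :: "'k \<Rightarrow> int \<Rightarrow> 'k"
  assumes rat: "rational_map F (ngon_coords n) (ngon_coords n) T" and T: "T P = Some Q"
    and n: "n \<ge> 2"
    and poly: "\<And>i. polyfun (\<lambda>t. c t i)" and ca: "c a = cross_ratio P"
    and gen: "\<forall>\<^sub>F t in cofinite. \<forall>i. c t i \<noteq> 0 \<and> c t (i + int n) = c t i"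
  shows "\<forall>\<^sub>F t in cofinite. \<exists>P' Q'. P' \<in> ngons n \<and> cross_ratio P' = c t \<and> T P' = Some Q'"
proof -
  obtain f \<xi> where f: "ngon_coords n P \<xi>" "ngon_coords n Q (\<lambda>j. mpoly_eval (f j) \<xi>)"
    "\<forall>P' \<xi> Q'. ngon_coords n P' \<xi> \<and> ngon_coords n Q' (\<lambda>j. mpoly_eval (f j) \<xi>) \<longrightarrow> T P' = Some Q'"
    using T by (rule rational_map_local_form[OF rat])
  have P: "P \<in> ngons n" using f(1) by (simp add: ngon_coords_def)
  obtain x y where xy: "recurrent (c a) x" "recurrent (c a) y" "lifts (fst P) x y"
    "\<And>i. bracket x y i (i + 1) \<noteq> 0"
    using recurrent_lift_exists[OF P] unfolding ca by blast
  define X where "X t m = rec_seq (c t) (x 0) (x 1) m" for t m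
  define Y where "Y t m = rec_seq (c t) (y 0) (y 1) m" for t m
  define D where "D = x 0 * y 1 - x 1 * y 0"
  \<comment> \<open>the frame map of the shift by a period, written with polynomials in \<open>t\<close>\<close>
  define A where "A t = (vector [vector [(X t n * y 1 - X t (n + 1) * y 0) / D, (X t (n + 1) * x 0 - X t n * x 1) / D],
    vector [(Y t n * y 1 - Y t (n + 1) * y 0) / D, (Y t (n + 1) * x 0 - Y t n * x 1) / D]] :: 'k^2^2)" for t
  have polyX: "polyfun (\<lambda>t. X t m)" "polyfun (\<lambda>t. Y t m)" for m
    unfolding X_def Y_def by (intro polyfun_rec_seq poly)+
  have member: "det (A t) \<noteq> 0 \<and> (\<exists>P'. P' \<in> ngons n \<and> cross_ratio P' = c t \<and> snd P' = abs_pgl2 (A t) \<and>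
      (\<forall>m. (X t m, Y t m) \<noteq> (0, 0) \<and> fst P' (int m) = mk_point (X t m) (Y t m)))"
    if ct: "\<forall>i. c t i \<noteq> 0 \<and> c t (i + int n) = c t i" for t
  proof -
    have c: "c t i \<noteq> 0" "c t (i + int n) = c t i" for i using ct by auto
    obtain x' where x': "x' 0 = x 0" "x' 1 = x 1" "recurrent (c t) x'"
      using recurrent_exists[of "c t" "x 0" "x 1", OF c(1)] by blast
    obtain y' where y': "y' 0 = y 0" "y' 1 = y 1" "recurrent (c t) y'"
      using recurrent_exists[of "c t" "y 0" "y 1", OF c(1)] by blast
    have br: "bracket x' y' 0 1 \<noteq> 0" using xy(4)[of 0] x' y' by (simp add: bracket_def)
    have X: "x' (int m) = X t m" "y' (int m) = Y t m" for m
      using recurrent_eq_rec_seq[OF x'(3)] recurrent_eq_rec_seq[OF y'(3)] x' y' by (simp_all add: X_def Y_def)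
    have "frame_map x' y' (\<lambda>i. x' (i + int n)) (\<lambda>i. y' (i + int n)) = A t"
      using X[of n] X[of "n + 1"] x' y' by (simp add: frame_map_def A_def D_def Let_def add.commute)
    note R = recurrent_polygon[OF c x'(3) y'(3) br, unfolded this]
    have "fst (\<lambda>i. mk_point (x' i) (y' i), abs_pgl2 (A t)) (int m) = mk_point (X t m) (Y t m)"
      "(X t m, Y t m) \<noteq> (0, 0)" for m
      using liftsD[OF R(4), of "int m"] by (simp_all add: X)
    with R show ?thesis by (intro conjI exI[of _ "(\<lambda>i. mk_point (x' i) (y' i), abs_pgl2 (A t))"]) auto
  qed
  have ca_gen: "\<forall>i. c a i \<noteq> 0 \<and> c a (i + int n) = c a i"
    using cross_ratio_nonzero[OF P] cross_ratio_periodic[OF P] by (simp add: ca)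
  have Xa: "X a m = x (int m)" "Y a m = y (int m)" for m
    using recurrent_eq_rec_seq[OF xy(1)] recurrent_eq_rec_seq[OF xy(2)] by (simp_all add: X_def Y_def)
  have br0: "bracket x y 0 1 \<noteq> 0" using xy(4)[of 0] by simp
  have Aa: "det (A a) \<noteq> 0" "snd P = abs_pgl2 (A a)"
  proof -
    have "frame_map x y (\<lambda>i. x (i + int n)) (\<lambda>i. y (i + int n)) = A a"
      using Xa[of n] Xa[of "n + 1"] by (simp add: frame_map_def A_def D_def Let_def add.commute)
    note R = recurrent_polygon[OF ca_gen[rule_format, THEN conjunct1] ca_gen[rule_format, THEN conjunct2]
        xy(1,2) br0, unfolded this]
    show "det (A a) \<noteq> 0" by (rule R)
    have "(\<lambda>i. mk_point (x i) (y i), abs_pgl2 (A a)) = P"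
      using liftsD(2)[OF xy(3)] by (intro ngon_eqI[OF R(2) P]) auto
    then show "snd P = abs_pgl2 (A a)" by (metis snd_conv)
  qed
  have "\<exists>s. s \<noteq> 0 \<and> \<xi> (2 * i) = s * X a i \<and> \<xi> (2 * i + 1) = s * Y a i" if "i < n" for i
  proof -
    have e: "(\<xi> (2 * i), \<xi> (2 * i + 1)) \<noteq> (0, 0)" "fst P (int i) = mk_point (\<xi> (2 * i)) (\<xi> (2 * i + 1))"
      using f(1) that by (auto simp: ngon_coords_def)
    have "X a i * \<xi> (2 * i + 1) = Y a i * \<xi> (2 * i)"
      using mk_point_eq_iff[OF liftsD(1)[OF xy(3)] e(1), of "int i"] e(2) liftsD(2)[OF xy(3), of "int i"]
      by (simp add: Xa algebra_simps)
    moreover have "(X a i, Y a i) \<noteq> (0, 0)" using liftsD(1)[OF xy(3), of "int i"] by (simp add: Xa)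
    ultimately show ?thesis using parallel_imp_scaled[OF _ e(1)] by metis
  qed
  then obtain \<sigma> where \<sigma>: "\<And>i. i < n \<Longrightarrow> \<sigma> i \<noteq> 0 \<and> \<xi> (2 * i) = \<sigma> i * X a i \<and> \<xi> (2 * i + 1) = \<sigma> i * Y a i"
    by metis
  define B where "B = (vector [vector [\<xi> (2 * n), \<xi> (2 * n + 1)], vector [\<xi> (2 * n + 2), \<xi> (2 * n + 3)]] :: 'k^2^2)"
  have "det B \<noteq> 0" "abs_pgl2 (A a) = abs_pgl2 B" using f(1) Aa(2) by (auto simp: ngon_coords_def Let_def B_def)
  then obtain \<tau> where \<tau>: "\<tau> \<noteq> 0" "B = mat \<tau> ** A a" using abs_pgl2_eqD[OF Aa(1)] by blast
  \<comment> \<open>The local form concerns the given coordinates \<open>\<xi>\<close> of \<open>P\<close>. The factors \<open>\<sigma>\<close> and \<open>\<tau>\<close> make the family pass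
    through \<open>\<xi>\<close>.\<close>
  define \<zeta> where "\<zeta> t j =
    (if j < 2 * n then \<sigma> (j div 2) * (if even j then X t (j div 2) else Y t (j div 2))
     else if j = 2 * n then \<tau> * A t $ 1 $ 1 else if j = 2 * n + 1 then \<tau> * A t $ 1 $ 2
     else if j = 2 * n + 2 then \<tau> * A t $ 2 $ 1 else if j = 2 * n + 3 then \<tau> * A t $ 2 $ 2 else \<xi> j)" for t j
  have \<zeta>_vertex: "\<zeta> t (2 * i) = \<sigma> i * X t i" "\<zeta> t (2 * i + 1) = \<sigma> i * Y t i" if "i < n" for t i
    using that by (auto simp: \<zeta>_def)
  have \<zeta>_matrix: "vector [vector [\<zeta> t (2 * n), \<zeta> t (2 * n + 1)], vector [\<zeta> t (2 * n + 2), \<zeta> t (2 * n + 3)]] = mat \<tau> ** A t" for t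
    unfolding mat2_eq_iff mat_mult_entry by (simp add: \<zeta>_def)
  have "\<zeta> a j = \<xi> j" for j
  proof (cases "j < 2 * n")
    case True
    then have "j div 2 < n" by simp
    with \<sigma>[OF this] True show ?thesis by (cases "even j") (auto simp: \<zeta>_def elim!: evenE oddE)
  next
    case False
    have "\<xi> (2 * n) = \<tau> * A a $ 1 $ 1" "\<xi> (2 * n + 1) = \<tau> * A a $ 1 $ 2"
      "\<xi> (2 * n + 2) = \<tau> * A a $ 2 $ 1" "\<xi> (2 * n + 3) = \<tau> * A a $ 2 $ 2"
      using \<tau>(2) unfolding B_def mat2_eq_iff mat_mult_entry by simp_all
    with False show ?thesis by (auto simp: \<zeta>_def)
  qed
  then have \<zeta>a: "\<zeta> a = \<xi>" by blast
  have "polyfun (\<lambda>t. A t $ 1 $ 1)" "polyfun (\<lambda>t. A t $ 1 $ 2)" "polyfun (\<lambda>t. A t $ 2 $ 1)" "polyfun (\<lambda>t. A t $ 2 $ 2)"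
    by (simp_all add: A_def) (intro polyfun_intros polyX)+
  then have "polyfun (\<lambda>t. \<zeta> t j)" for j
    unfolding \<zeta>_def by (intro polyfun_intros polyX)
  then have "\<forall>\<^sub>F t in cofinite. \<exists>Q'. ngon_coords n Q' (\<lambda>j. mpoly_eval (f j) (\<zeta> t))"
    using f(2) by (intro ngon_coords_open[OF n, where a = a] polyfun_mpoly_eval) (simp_all add: \<zeta>a)
  with gen show ?thesis
  proof eventually_elim
    case (elim t)
    from member[OF elim(1)] obtain P' where P': "det (A t) \<noteq> 0" "P' \<in> ngons n" "cross_ratio P' = c t"
      "snd P' = abs_pgl2 (A t)" "\<And>m. (X t m, Y t m) \<noteq> (0, 0)" "\<And>m. fst P' (int m) = mk_point (X t m) (Y t m)"
      by blast
    have "ngon_coords n P' (\<zeta> t)"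
      unfolding ngon_coords_def Let_def \<zeta>_matrix
    proof (intro conjI allI impI)
      fix i assume "i < n"
      with \<sigma>[of i] P'(5)[of i] show "(\<zeta> t (2 * i), \<zeta> t (2 * i + 1)) \<noteq> (0, 0)"
        "fst P' (int i) = mk_point (\<zeta> t (2 * i)) (\<zeta> t (2 * i + 1))"
        unfolding \<zeta>_vertex[OF \<open>i < n\<close>] by (auto simp: P'(6) mk_point_scale)
    qed (use P' \<tau> in \<open>simp_all add: abs_pgl2_scale\<close>)
    with elim(2) f(3) P' show ?case by blast
  qed
qed

section \<open>Traces along an orbit and invariance\<close>

text \<open>Frames are mapped to frames, so a scalar product multiplies \<open>q\<^sub>1\<close> and \<open>q\<^sub>2\<close> by the same factor
  after a period, and by the recurrence all the other lifts as well.\<close>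

lemma L_product_scalar_imp_closed:
  assumes "P \<in> ngons n" "L_product n (cross_ratio P) = mat \<nu>"
  shows "closed_polygon P"
proof -
  define c where "c = cross_ratio P"
  have c: "c i \<noteq> 0" "c (i + int n) = c i" for i
    using cross_ratio_nonzero[OF assms(1)] cross_ratio_periodic[OF assms(1)] by (auto simp: c_def)
  obtain x y where xy: "recurrent c x" "recurrent c y" "lifts (fst P) x y" "\<And>i. bracket x y i (i + 1) \<noteq> 0"
    using recurrent_lift_exists[OF assms(1)] unfolding c_def by blast
  have "frame x y 1 ** L_product m c = frame x y (int m + 1)" for m
  proof (induction m)
    case (Suc m)
    have "frame x y (int m + 1) ** L_matrix (c (int m + 1)) = frame x y (int m + 1 + 1)"
      using frame_L_matrix[OF xy(1,2) c(1) xy(4), of "int m + 1" 0]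
      by (simp add: mat2_eq_iff mat_mult_entry mat2_mult_nth mat_def)
    with Suc show ?case by (simp add: matrix_mul_assoc add.commute)
  qed simp
  from this[of n] have F: "frame x y (int n + 1) = mat \<nu> ** frame x y 1"
    using assms(2) by (simp add: c_def mat_commute)
  have e: "x (1 + int n) = \<nu> * x 1" "x (2 + int n) = \<nu> * x 2" "y (1 + int n) = \<nu> * y 1" "y (2 + int n) = \<nu> * y 2"
    using F unfolding mat2_eq_iff mat_mult_entry by (simp_all add: frame_def add.commute)
  have "\<nu> \<noteq> 0"
    using e(1,3) liftsD(1)[OF xy(3), of "1 + int n"] by auto
  have "z (i + int n) = \<nu> * z i" if z: "recurrent c z" "z (1 + int n) = \<nu> * z 1" "z (2 + int n) = \<nu> * z 2" for z i
  proof -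
    have "z (int n + 2) = z (int n + 1) - c 0 * z (int n)" "z 2 = z 1 - c 0 * z 0"
      using recurrentD[OF z(1), of "int n"] recurrentD[OF z(1), of 0] c(2)[of 0] by simp_all
    note e = this
    have "c 0 * z (int n) = \<nu> * z 1 - \<nu> * z 2"
    proof -
      have "\<nu> * z 2 = \<nu> * z 1 - c 0 * z (int n)"
        using e(1) z(2,3) by (simp add: add.commute)
      then show ?thesis by simp
    qed
    also have "\<dots> = c 0 * (\<nu> * z 0)" unfolding e(2) by (simp add: algebra_simps)
    finally have "c 0 * z (int n) = c 0 * (\<nu> * z 0)" .
    with c(1)[of 0] have "z (0 + int n) = \<nu> * z 0" by simp
    with recurrent_unique[OF c(1) recurrent_shift[OF z(1) c(2)] recurrent_linear[OF z(1,1), of \<nu> 0], of i] z(2)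
    show ?thesis by simp
  qed
  with e xy(1,2) have "\<forall>i. x (i + int n) = \<nu> * x i \<and> y (i + int n) = \<nu> * y i" by blast
  with closed_iff_lift_quasiperiodic[OF assms(1) xy(1,2)[unfolded c_def] xy(3)] \<open>\<nu> \<noteq> 0\<close>
  show ?thesis by blast
qed

lemma scalar_normalization:
  assumes "\<nu> \<noteq> 0"
  shows "(THE \<mu>. mat \<mu> ** mat \<nu> = (mat 1 :: 'k::field^2^2)) = 1 / \<nu>"
proof (rule the_equality)
  show "mat (1 / \<nu>) ** mat \<nu> = (mat 1 :: 'k^2^2)"
    using assms by (simp add: mat2_eq_iff mat_mult_entry) (simp add: mat_def)
next
  fix \<mu> assume "mat \<mu> ** mat \<nu> = (mat 1 :: 'k^2^2)"
  then have "\<mu> * \<nu> = 1" by (simp add: mat2_eq_iff mat_mult_entry) (simp add: mat_def)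
  with assms show "\<mu> = 1 / \<nu>" by (simp add: field_simps)
qed

lemma rational_Gm_actionD:
  assumes "rational_Gm_action F n \<rho>"
  shows "rational_map F (Gm_moduli_coords n) (moduli_coords n) (\<lambda>(t, x). \<rho> t x)"
    "\<rho> 1 x = Some y \<Longrightarrow> y = x"
proof -
  show "rational_map F (Gm_moduli_coords n) (moduli_coords n) (\<lambda>(t, x). \<rho> t x)"
    using assms unfolding rational_Gm_action_def by (rule conjunct1)
  have "\<forall>x y. \<rho> 1 x = Some y \<longrightarrow> y = x"
    using assms unfolding rational_Gm_action_def by (elim conjE)
  then show "\<rho> 1 x = Some y \<Longrightarrow> y = x" by simp
qed

lemma cr_t_at_1:
  fixes \<rho> :: "'k::field \<Rightarrow> 'k polygon set \<Rightarrow> 'k polygon set option"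
  assumes "infinite (UNIV :: 'k set)" "rational_Gm_action F n \<rho>" "n > 0" "\<rho> 1 (cls P) \<noteq> None"
  shows "cr_t \<rho> P i 1 = cross_ratio P i"
proof -
  obtain y where "\<rho> 1 (cls P) = Some y" using assms(4) by auto
  moreover from this have "y = cls P" by (rule rational_Gm_actionD(2)[OF assms(2)])
  ultimately show ?thesis
    using cr_t_eq_class_cr[OF assms(1) rational_Gm_actionD(1)[OF assms(2)] assms(3)] by simp
qed

lemma G_eq_trace_coeff:
  "G n \<rho> P k = trace_coeff (fst P) (\<lambda>i. cr_t' \<rho> P i 1 / cr_t \<rho> P i 1) n k"
  by (simp only: G_def trace_coeff_def)

text \<open>Linearity of the symmetry enters here: it supplies the values of all \<open>c\<^sub>i(t)\<close> with \<open>t \<noteq> 0\<close>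
  in the form to which the expansion of the product applies, with \<open>s = t - 1\<close>.\<close>

lemma trace_along_orbit:
  fixes \<rho> :: "'k::field \<Rightarrow> 'k polygon set \<Rightarrow> 'k polygon set option"
  assumes "infinite (UNIV :: 'k set)" "rational_Gm_action F n \<rho>" "n > 0" "linear_scaling n \<rho>"
    and P: "P \<in> ngons n" "closed_polygon P" "\<rho> 1 (cls P) \<noteq> None"
  obtains \<nu> where "\<nu> \<noteq> 0" "L_product n (cross_ratio P) = mat \<nu>"
    "\<forall>t. monodromy_t n \<rho> P t = mat (1 / \<nu>) ** L_product n (\<lambda>i. cr_t \<rho> P i t)"
    "\<forall>t. t \<noteq> 0 \<longrightarrow> trace (L_product n (\<lambda>i. cr_t \<rho> P i t)) = \<nu> * (\<Sum>k\<le>n div 2. G n \<rho> P k * (t - 1) ^ k)"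
proof -
  note cr1 = cr_t_at_1[OF assms(1-3) P(3)]
  obtain \<nu> where \<nu>: "\<nu> \<noteq> 0" "L_product n (cross_ratio P) = mat \<nu>"
    "\<forall>d s. trace (L_product n (\<lambda>i. cross_ratio P i + d i * s)) =
       \<nu> * (\<Sum>k\<le>n div 2. trace_coeff (fst P) (\<lambda>i. d i / cross_ratio P i) n k * s ^ k)"
    by (rule L_product_closed[OF P(1,2)])
  show ?thesis
  proof (rule that[OF \<nu>(1,2)])
    show "\<forall>t. monodromy_t n \<rho> P t = mat (1 / \<nu>) ** L_product n (\<lambda>i. cr_t \<rho> P i t)"
      unfolding monodromy_t_def cr1 \<nu>(2) scalar_normalization[OF \<nu>(1)] by (rule allI) (rule refl)
    show "\<forall>t. t \<noteq> 0 \<longrightarrow>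
      trace (L_product n (\<lambda>i. cr_t \<rho> P i t)) = \<nu> * (\<Sum>k\<le>n div 2. G n \<rho> P k * (t - 1) ^ k)"
    proof (intro allI impI)
      fix t :: 'k assume "t \<noteq> 0"
      then have "cr_t \<rho> P i t = cross_ratio P i + cr_t' \<rho> P i 1 * (t - 1)" for i
        using assms(4) P(1,3) cr1 unfolding linear_scaling_def by metis
      then show "trace (L_product n (\<lambda>i. cr_t \<rho> P i t)) = \<nu> * (\<Sum>k\<le>n div 2. G n \<rho> P k * (t - 1) ^ k)"
        by (simp only: \<nu>(3) G_eq_trace_coeff cr1)
    qed
  qed
qed

lemma symmetry_generically_defined:
  assumes "rational_Gm_action F n \<rho>" "n > 0" "\<rho> 1 x \<noteq> None"
  shows "\<forall>\<^sub>F t in cofinite. \<rho> t x \<noteq> None"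
proof -
  obtain y where y: "\<rho> 1 x = Some y" using assms(3) by auto
  note rat = rational_Gm_actionD(1)[OF assms(1)]
  obtain N D where "\<forall>\<^sub>F t in cofinite. \<exists>z. \<rho> t x = Some z \<and> (\<forall>i::int. class_cr z i = poly (N i) t / poly D t)"
    using symmetry_rational_in_parameter[OF rat assms(2) y] by blast
  then show ?thesis by eventually_elim auto
qed

text \<open>Since \<open>T\<close> preserves the matrices \<open>L\<^sub>1\<cdots>L\<^sub>n\<close> up to conjugation and a factor \<open>\<kappa>\<close>, the image of a
  closed polygon is closed. For almost all \<open>t\<close> there is a polygon \<open>P'\<close> in the deformed class of \<open>P\<close> at which
  \<open>T\<close> is defined. As the symmetry commutes with \<open>T\<close>, the image of \<open>P'\<close> lies in the deformed class
  of \<open>Q\<close>. The factor \<open>\<kappa>\<close> is the same at \<open>t\<close> as at \<open>1\<close>, so it is absorbed by the normalisation of the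
  two monodromies at \<open>1\<close>. Their traces agree for almost all \<open>t\<close>, hence so do the coefficients.\<close>

lemma G_preserved:
  fixes \<rho> :: "'k::field \<Rightarrow> 'k polygon set \<Rightarrow> 'k polygon set option"
  assumes inf: "infinite (UNIV :: 'k set)" and "n > 0"
    and T: "rational_map F (ngon_coords n) (ngon_coords n) T"
    and sym: "scaling_symmetry F n T \<rho>" and lin: "linear_scaling n \<rho>"
    and mon: "preserves_monodromy n T \<rho>"
    and P: "P \<in> ngons n" "closed_polygon P" "\<rho> 1 (cls P) \<noteq> None"
    and Q: "T P = Some Q" "\<rho> 1 (cls Q) \<noteq> None"
    and k: "k \<le> n div 2"
  shows "G n \<rho> Q k = G n \<rho> P k"
proof -
  have Gm: "rational_Gm_action F n \<rho>"
    and commute: "\<And>t x x' y y' z. induced T x y \<Longrightarrow> \<rho> t x = Some x' \<Longrightarrow> induced T x' z \<Longrightarrow> \<rho> t y = Some y' \<Longrightarrow> z = y'"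
    using sym unfolding scaling_symmetry_def by blast+
  note rat = rational_Gm_actionD(1)[OF Gm]
  obtain \<kappa> where \<kappa>: "\<And>x. \<kappa> x \<noteq> 0" "\<And>t x y. \<rho> t x = Some y \<Longrightarrow> \<kappa> y = \<kappa> x"
    "\<And>P Q. T P = Some Q \<Longrightarrow> \<exists>S. invertible S \<and>
       L_product n (cross_ratio Q) = mat (\<kappa> (cls P)) ** (S ** L_product n (cross_ratio P) ** matrix_inv S)"
    using mon unfolding preserves_monodromy_def by blast
  obtain \<nu> where \<nu>: "\<nu> \<noteq> 0" "L_product n (cross_ratio P) = mat \<nu>"
    "\<forall>t. t \<noteq> 0 \<longrightarrow> trace (L_product n (\<lambda>i. cr_t \<rho> P i t)) = \<nu> * (\<Sum>k\<le>n div 2. G n \<rho> P k * (t - 1) ^ k)"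
    by (rule trace_along_orbit[OF inf Gm \<open>n > 0\<close> lin P])
  have Qn: "Q \<in> ngons n"
    using Q(1) by (rule rational_map_local_form[OF T]) (simp add: ngon_coords_def)
  obtain S :: "'k^2^2" where S: "invertible S" "L_product n (cross_ratio Q) = mat (\<kappa> (cls P)) ** (S ** mat \<nu> ** matrix_inv S)"
    using \<kappa>(3)[OF Q(1)] unfolding \<nu>(2) by blast
  have "S ** mat \<nu> ** matrix_inv S = mat \<nu> ** (S ** matrix_inv S)"
    unfolding mat_commute[of \<nu> S, symmetric] by (simp only: matrix_mul_assoc)
  then have LQ: "L_product n (cross_ratio Q) = mat (\<kappa> (cls P) * \<nu>)"
    unfolding S(2) by (simp add: matrix_inv_cancel[OF S(1)] mat2_eq_iff mat_mult_entry) (simp add: mat_def)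
  have Qc: "closed_polygon Q" by (rule L_product_scalar_imp_closed[OF Qn LQ])
  obtain \<nu>' where \<nu>': "\<nu>' \<noteq> 0" "L_product n (cross_ratio Q) = mat \<nu>'"
    "\<forall>t. t \<noteq> 0 \<longrightarrow> trace (L_product n (\<lambda>i. cr_t \<rho> Q i t)) = \<nu>' * (\<Sum>k\<le>n div 2. G n \<rho> Q k * (t - 1) ^ k)"
    by (rule trace_along_orbit[OF inf Gm \<open>n > 0\<close> lin Qn Qc Q(2)])
  have "(mat (\<kappa> (cls P) * \<nu>) :: 'k^2^2) $ 1 $ 1 = (mat \<nu>' :: 'k^2^2) $ 1 $ 1" using LQ \<nu>'(2) by simp
  then have \<nu>'_eq: "\<nu>' = \<kappa> (cls P) * \<nu>" by (simp add: mat_def)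
  \<comment> \<open>by linearity, these are the cross-ratios of the deformed class\<close>
  define c where "c t i = cross_ratio P i + cr_t' \<rho> P i 1 * (t - 1)" for t i
  have crP: "cr_t \<rho> P i t = c t i" if "t \<noteq> 0" for t i
    using lin P(1,3) that cr_t_at_1[OF inf Gm \<open>n > 0\<close> P(3)] unfolding c_def linear_scaling_def by metis
  have defP: "\<forall>\<^sub>F t in cofinite. \<rho> t (cls P) \<noteq> None"
    by (rule symmetry_generically_defined[OF Gm \<open>n > 0\<close> P(3)])
  have defQ: "\<forall>\<^sub>F t in cofinite. \<rho> t (cls Q) \<noteq> None"
    by (rule symmetry_generically_defined[OF Gm \<open>n > 0\<close> Q(2)])
  have deformed: "\<exists>R. R \<in> ngons n \<and> \<rho> t (cls P) = Some (cls R) \<and> cross_ratio R = c t \<and> t \<noteq> 0"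
    if defined: "\<rho> t (cls P) \<noteq> None" for t
  proof -
    obtain z where z: "\<rho> t (cls P) = Some z" using defined by (cases "\<rho> t (cls P)") simp_all
    note z_moduli = symmetry_in_moduli[OF rat z]
    obtain R where R: "R \<in> ngons n" "z = cls R" "\<And>i. class_cr z i = cross_ratio R i"
      using moduliE[OF z_moduli(3)] by blast
    have "cross_ratio R i = c t i" for i
      using cr_t_eq_class_cr[OF inf rat \<open>n > 0\<close> z, of i] crP[OF z_moduli(1), of i] R(3)[of i] by simp
    with R z z_moduli(1) show ?thesis by blast
  qed
  have "\<forall>\<^sub>F t in cofinite. \<forall>i. c t i \<noteq> 0 \<and> c t (i + int n) = c t i"
    using defP
  proof eventually_elim
    case (elim t)
    from deformed[OF this] cross_ratio_nonzero cross_ratio_periodic show ?case by metis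
  qed
  moreover have "polyfun (\<lambda>t. c t i)" for i unfolding c_def by (intro polyfun_intros)
  moreover have "c 1 = cross_ratio P" by (auto simp: c_def)
  ultimately have "\<forall>\<^sub>F t in cofinite. \<exists>P' Q'. P' \<in> ngons n \<and> cross_ratio P' = c t \<and> T P' = Some Q'"
    using transformation_defined_along_family[OF T Q(1) closed_ngon_size[OF P(1,2) \<open>n > 0\<close>]] by blast
  then have "\<forall>\<^sub>F t in cofinite. (\<Sum>k\<le>n div 2. G n \<rho> Q k * (t - 1) ^ k) = (\<Sum>k\<le>n div 2. G n \<rho> P k * (t - 1) ^ k)"
    using defP defQ
  proof eventually_elim
    case (elim t)
    obtain P' Q' where P': "P' \<in> ngons n" "cross_ratio P' = c t" "T P' = Some Q'" using elim(1) by blast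
    obtain R where R: "R \<in> ngons n" "\<rho> t (cls P) = Some (cls R)" "cross_ratio R = c t" "t \<noteq> 0"
      using deformed[OF elim(2)] by blast
    have RP': "cls R = cls P'" using cross_ratio_eq_imp_cls_eq[OF R(1) P'(1)] R(3) P'(2) by simp
    obtain w where w: "\<rho> t (cls Q) = Some w" using elim(3) by auto
    have "induced T (cls P) (cls Q)" "induced T (cls P') (cls Q')"
      using Q(1) P'(3) unfolding induced_def by blast+
    then have "cls Q' = w" using commute R(2) w unfolding RP' by blast
    then have "cr_t \<rho> Q i t = cross_ratio Q' i" for i
      using cr_t_eq_class_cr[OF inf rat \<open>n > 0\<close> w, of i] by auto
    then have "trace (L_product n (\<lambda>i. cr_t \<rho> Q i t)) = trace (L_product n (cross_ratio Q'))" by simp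
    also obtain S where "invertible S"
      "L_product n (cross_ratio Q') = mat (\<kappa> (cls P')) ** (S ** L_product n (cross_ratio P') ** matrix_inv S)"
      using \<kappa>(3)[OF P'(3)] by blast
    then have "trace (L_product n (cross_ratio Q')) = \<kappa> (cls P') * trace (L_product n (cross_ratio P'))"
      by (simp only: trace_mat_mult trace_similar)
    also have "\<kappa> (cls P') = \<kappa> (cls P)" using \<kappa>(2)[OF R(2)] by (simp add: RP')
    also have "cross_ratio P' = (\<lambda>i. cr_t \<rho> P i t)" using P'(2) crP[OF R(4)] by auto
    finally have "\<kappa> (cls P) * \<nu> * (\<Sum>k\<le>n div 2. G n \<rho> Q k * (t - 1) ^ k) =
        \<kappa> (cls P) * \<nu> * (\<Sum>k\<le>n div 2. G n \<rho> P k * (t - 1) ^ k)"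
      unfolding \<nu>(3)[rule_format, OF R(4)] \<nu>'(3)[rule_format, OF R(4)] \<nu>'_eq by (simp only: mult.assoc)
    with \<nu>(1) \<kappa>(1)[of "cls P"] show ?case by simp
  qed
  from shifted_coefficients_unique[OF inf this k] show ?thesis .
qed

theorem proposition4p5:
  fixes F :: "'k::field set" and n :: nat
    and T :: "'k polygon \<Rightarrow> 'k polygon option"
    and \<rho> :: "'k \<Rightarrow> 'k polygon set \<Rightarrow> 'k polygon set option"
    and P :: "'k polygon"
  assumes "is_subfield F" and "infinite (UNIV :: 'k set)" and "n > 0"
    and "polygonal_transformation F n T"
    and "scaling_symmetry F n T \<rho>"
    and "linear_scaling n \<rho>"
    and "preserves_monodromy n T \<rho>"
    and "P \<in> ngons n" and "closed_polygon P"
    and "\<rho> 1 (cls P) \<noteq> None"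
  shows "(\<forall>k \<le> n div 2. \<forall>Q. T P = Some Q \<and> \<rho> 1 (cls Q) \<noteq> None \<longrightarrow> G n \<rho> Q k = G n \<rho> P k) \<and>
    (\<forall>k \<le> n div 2. \<forall>A. G n \<rho> (act A P) k = G n \<rho> P k) \<and>
    monodromy_t n \<rho> P 1 = mat 1 \<and>
    (\<forall>t. t \<noteq> 0 \<longrightarrow> trace (monodromy_t n \<rho> P t) = (\<Sum>k\<le>n div 2. G n \<rho> P k * (t - 1) ^ k))"
proof -
  note inf = assms(2) and n = assms(3) and lin = assms(6) and P = assms(8-10)
  have Gm: "rational_Gm_action F n \<rho>" using assms(5) by (simp add: scaling_symmetry_def)
  have T: "rational_map F (ngon_coords n) (ngon_coords n) T"
    using assms(4) by (simp add: polygonal_transformation_def birational_map_def)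
  have trace: "trace (monodromy_t n \<rho> R t) = (\<Sum>k\<le>n div 2. G n \<rho> R k * (t - 1) ^ k)"
    if R: "R \<in> ngons n" "closed_polygon R" "\<rho> 1 (cls R) \<noteq> None" and "t \<noteq> 0" for R t
  proof -
    obtain \<nu> where "\<nu> \<noteq> 0" "monodromy_t n \<rho> R t = mat (1 / \<nu>) ** L_product n (\<lambda>i. cr_t \<rho> R i t)"
      "trace (L_product n (\<lambda>i. cr_t \<rho> R i t)) = \<nu> * (\<Sum>k\<le>n div 2. G n \<rho> R k * (t - 1) ^ k)"
      using trace_along_orbit[OF inf Gm n lin R] \<open>t \<noteq> 0\<close> by metis
    then show ?thesis by (simp add: trace_mat_mult)
  qed
  have "G n \<rho> (act A P) k = G n \<rho> P k" if "k \<le> n div 2" for k A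
  proof -
    have "cr_t \<rho> (act A P) = cr_t \<rho> P" unfolding cr_t_def by (simp only: cls_act)
    \<comment> \<open>the monodromy depends on the class only, so its trace has the same coefficients for \<open>act A P\<close> and \<open>P\<close>\<close>
    then have "monodromy_t n \<rho> (act A P) = monodromy_t n \<rho> P" unfolding monodromy_t_def by simp
    then have eq: "(\<Sum>k\<le>n div 2. G n \<rho> (act A P) k * (t - 1) ^ k) = (\<Sum>k\<le>n div 2. G n \<rho> P k * (t - 1) ^ k)"
      if "t \<noteq> 0" for t
      using trace[OF P that] trace[OF act_in_ngons[OF P(1)] closed_act[OF P(2)] _ that, of A] P(3) by (simp add: cls_act)
    have "\<forall>\<^sub>F t::'k in cofinite. t \<noteq> 0" by (simp add: eventually_cofinite)
    then have "\<forall>\<^sub>F t in cofinite.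
        (\<Sum>k\<le>n div 2. G n \<rho> (act A P) k * (t - 1) ^ k) = (\<Sum>k\<le>n div 2. G n \<rho> P k * (t - 1) ^ k)"
      by (rule eventually_mono) (rule eq)
    from shifted_coefficients_unique[OF inf this that] show ?thesis .
  qed
  moreover have "monodromy_t n \<rho> P 1 = mat 1"
  proof -
    obtain \<nu> where "\<nu> \<noteq> 0" "L_product n (cross_ratio P) = mat \<nu>"
      "monodromy_t n \<rho> P 1 = mat (1 / \<nu>) ** L_product n (\<lambda>i. cr_t \<rho> P i 1)"
      using trace_along_orbit[OF inf Gm n lin P] by metis
    then show ?thesis
      by (simp add: cr_t_at_1[OF inf Gm n P(3)] mat2_eq_iff mat_mult_entry) (simp add: mat_def)
  qed
  ultimately show ?thesis
    using G_preserved[OF inf n T assms(5-7) P] trace[OF P] by blast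
qed

end
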